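(* Let $n\ge 1$ and $0\le \ell'\le \ell$ be integers, and let $N=\ell(n-1)+\ell'+1$. Let $\vec{x}=(x_1,\dots,x_N)$, $\vec{y}=(y_1,\dots,y_N)$ and $\vec{z}=(z_1,\dots,z_{2n-2})$ be indeterminates. Then $$\det\left(s_{\lambda_{n,\ell,\ell'}}(z_1,\dots,z_{2n-2},x_i,y_j)\right)_{1\le i,j\le N} = c(n,\ell,\ell')\,\Delta(\vec{x})\,\Delta(\vec{y})\,\Big(\prod_{i=1}^{2n-2} z_i^{\ell'(\ell+1)}\Big)\, \big(s_{\mu_{2n-2,\ell+1}}(\vec{z})\big)^{\ell}\, \big(s_{\lambda_{n-1,\ell,\ell'}}(\vec{z})\big)^{\ell(n-2)+\ell'-1},$$ where $$c(n,\ell,\ell')=\begin{cases}(-1)^{(n-1)\binom{\ell+1}{2}+\binom{\ell'+1}{2}} & \text{if } n=1 \text{ or } \gcd(\ell+2,\ell'+1)=1,\\ 0 & \text{if } n>1 \text{ and } \gcd(\ell+2,\ell'+1)\ne 1.\end{cases}$$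
   Context: For a partition $\lambda=(\lambda_1\ge\dots\ge\lambda_k\ge 0)$ of length $k$ (zero parts allowed), the Schur polynomial in $k$ variables is $$s_\lambda(z_1,\dots,z_k)=\frac{\det(z_i^{\lambda_j+k-j})_{1\le i,j\le k}}{\det(z_i^{k-j})_{1\le i,j\le k}}.$$ The Schur polynomial of the empty partition in zero variables equals $1$ (this occurs for $n=1$). For a tuple $\vec{x}=(x_1,\dots,x_N)$, $\Delta(\vec{x})=\prod_{1\le i<j\le N}(x_i-x_j)$. The 2-staircase partition $\lambda_{n,\ell,\ell'}$ is the partition of length $2n$ $$\lambda_{n,\ell,\ell'}=\big((n-1)\ell+\ell',(n-1)\ell,(n-2)\ell+\ell',(n-2)\ell,\dots,\ell',0\big),$$ i.e. $(\lambda_{n,\ell,\ell'})_{2j-1}=(n-j)\ell+\ell'$ and $(\lambda_{n,\ell,\ell'})_{2j}=(n-j)\ell$ for $1\le j\le n$; $\lambda_{0,\ell,\ell'}$ is the empty partition. The staircase partition $\mu_{m,h}$ is the partition of length $m$, $\mu_{m,h}=((m-1)h,(m-2)h,\dots,h,0)$; $\mu_{0,h}$ is the empty partition. *)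

theory Defs
  imports
    "HOL-Library.Poly_Mapping"
    "HOL-Computational_Algebra.Fraction_Field"
    "Jordan_Normal_Form.Determinant"
begin

text \<open>
  Multivariate polynomials over the integers in countably many indeterminates, as finitely
  supported maps from monomials (exponent vectors) to coefficients, and their field of fractions.
  Working in the latter, quotients of alternants and integer powers can be written literally.
\<close>

type_synonym int_mpoly = "(nat \<Rightarrow>\<^sub>0 nat) \<Rightarrow>\<^sub>0 int"

definition indet :: "nat \<Rightarrow> int_mpoly fract" where
  "indet i = Fract (Poly_Mapping.single (Poly_Mapping.single i 1) 1) 1"

text \<open>
  Lists are indexed from 0, so the exponent \<open>\<lambda>\<^sub>j + k - j\<close> for \<open>1 \<le> j \<le> k\<close>
  becomes \<open>lam ! j + (k - Suc j)\<close> for \<open>j < k\<close>. The quotient is meaningful when \<open>zs\<close> has the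
  same length as \<open>lam\<close> and distinct entries, e.g. distinct indeterminates.
\<close>

definition schur :: "nat list \<Rightarrow> 'a::field list \<Rightarrow> 'a" where
  "schur lam zs = (let k = length lam in
     det (mat k k (\<lambda>(i, j). (zs ! i) ^ (lam ! j + (k - Suc j)))) /
     det (mat k k (\<lambda>(i, j). (zs ! i) ^ (k - Suc j))))"

definition Delta :: "'a::comm_ring_1 list \<Rightarrow> 'a" where
  "Delta xs = (\<Prod>j<length xs. \<Prod>i<j. xs ! i - xs ! j)"

definition two_staircase :: "nat \<Rightarrow> nat \<Rightarrow> nat \<Rightarrow> nat list" where
  "two_staircase n l l' = concat (map (\<lambda>j. [(n - j) * l + l', (n - j) * l]) [1..<Suc n])"

definition staircase :: "nat \<Rightarrow> nat \<Rightarrow> nat list" where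
  "staircase m h = map (\<lambda>j. (m - j) * h) [1..<Suc m]"

definition det_const :: "nat \<Rightarrow> nat \<Rightarrow> nat \<Rightarrow> int" where
  "det_const n l l' =
     (if n = 1 \<or> gcd (l + 2) (l' + 1) = 1
      then (-1) ^ ((n - 1) * ((l + 1) choose 2) + ((l' + 1) choose 2))
      else 0)"

lemma length_staircase [simp]: "length (staircase m h) = m"
  by (simp add: staircase_def)

lemma two_staircase_0 [simp]: "two_staircase 0 l l' = []"
  by (simp add: two_staircase_def)

lemma two_staircase_Suc:
  "two_staircase (Suc n) l l' = (n * l + l') # (n * l) # two_staircase n l l'"
proof -
  have "[1..<Suc (Suc n)] = 1 # map Suc [1..<Suc n]"
    by (simp add: map_Suc_upt upt_conv_Cons del: upt_Suc)
  then show ?thesis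
    by (simp add: two_staircase_def o_def del: upt_Suc)
qed

lemma length_two_staircase [simp]: "length (two_staircase n l l') = 2 * n"
  by (induction n) (simp_all add: two_staircase_Suc)

lemma indet_eq_iff: "indet i = indet j \<longleftrightarrow> i = j"
proof
  assume "indet i = indet j"
  then have "Poly_Mapping.single (Poly_Mapping.single i (1::nat)) (1::int) =
             Poly_Mapping.single (Poly_Mapping.single j 1) 1"
    by (simp add: indet_def eq_fract)
  then have "Poly_Mapping.single i (1::nat) = Poly_Mapping.single j 1"
    by (metis keys_single singleton_inject zero_neq_one)
  then show "i = j"
    by (metis keys_single singleton_inject zero_neq_one)
qed simp

end

theory Submission
  imports Defs "HOL-Algebra.Algebraic_Closure_Type"
begin

hide_const (open) Polynomials.degree Polynomials.lead_coeff up_ring.coeff up_ring.monom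

text \<open>
  Put \<open>h = n - 1\<close>, \<open>r = l + 2\<close>, \<open>p = l' + 1\<close>. The numerator of \<open>s(z, x, y)\<close> is the alternant of the
  functions \<open>a(x\<^sup>r) + x\<^sup>p b(x\<^sup>r)\<close> with \<open>deg a, deg b \<le> h\<close>. Those vanishing at the \<open>2 h\<close> points
  \<open>z\<^sub>i\<close> form a pencil spanned by \<open>P F = a\<^sub>1(x\<^sup>r) + x\<^sup>p b\<^sub>1(x\<^sup>r)\<close> and \<open>P G = a\<^sub>2(x\<^sup>r) + x\<^sup>p b\<^sub>2(x\<^sup>r)\<close>, where
  \<open>P = \<Prod>\<^sub>i (x - z\<^sub>i)\<close> and \<open>F\<close> has degree \<open>N\<close>. Hence \<open>s(z, x, y)\<close> is \<open>s(z)\<close> times the Bezoutian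
  of \<open>F\<close> and \<open>G\<close>, whose determinant is, up to Vandermonde factors, the resultant \<open>\<Prod> G(\<phi>)\<close>
  over the roots \<open>\<phi>\<close> of \<open>F\<close>.
  The resultant follows from \<open>b\<^sub>1(x\<^sup>r) G - b\<^sub>2(x\<^sup>r) F = \<Prod>\<^sub>i \<Prod>\<^sub>\<zeta> (x - \<zeta> z\<^sub>i)\<close>, the product running
  over \<open>\<zeta>\<^sup>r = 1\<close>, \<open>\<zeta> \<noteq> 1\<close>, together with \<open>(P F)(\<zeta> z\<^sub>i) = (\<zeta>\<^sup>p - 1) z\<^sub>i\<^sup>p b\<^sub>1(z\<^sub>i\<^sup>r)\<close>; the product
  of the factors \<open>\<zeta>\<^sup>p - 1\<close> is where the coprimality condition comes from. The unknown values
  \<open>b\<^sub>1(z\<^sub>i\<^sup>r)\<close> cancel against \<open>\<Prod> b\<^sub>1(\<phi>\<^sup>r)\<close>, because a Sylvester determinant relates both to the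
  resultant of \<open>a\<^sub>1\<close> and \<open>b\<^sub>1\<close>.
\<close>

section \<open>Determinants of evaluated polynomials\<close>

text \<open>Determinant given by an entry function, so that row and column manipulations become
  rewriting of lambda terms without carrier conditions.\<close>

definition fdet :: "nat \<Rightarrow> (nat \<Rightarrow> nat \<Rightarrow> 'a) \<Rightarrow> 'a::comm_ring_1" where
  "fdet n a = det (mat n n (\<lambda>(i, j). a i j))"

lemma fdet_cong:
  assumes "\<And>i j. i < n \<Longrightarrow> j < n \<Longrightarrow> a i j = b i j"
  shows "fdet n a = fdet n b"
  unfolding fdet_def by (rule arg_cong[where f = det], rule eq_matI) (auto simp: assms)

lemma fdet_transpose: "fdet n (\<lambda>i j. a j i) = fdet n a"
proof -
  have "mat n n (\<lambda>(i, j). a j i) = transpose_mat (mat n n (\<lambda>(i, j). a i j))"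
    by (rule eq_matI) auto
  then show ?thesis
    unfolding fdet_def by (simp add: det_transpose[of _ n])
qed

lemma fdet_mult:
  assumes "\<And>i j. i < n \<Longrightarrow> j < n \<Longrightarrow> a i j = (\<Sum>k<n. b i k * c k j)"
  shows "fdet n a = fdet n b * fdet n c"
proof -
  have "mat n n (\<lambda>(i, j). a i j) = mat n n (\<lambda>(i, j). b i j) * mat n n (\<lambda>(i, j). c i j)"
    by (rule eq_matI) (auto simp: assms scalar_prod_def atLeast0LessThan)
  then show ?thesis
    unfolding fdet_def by (simp add: det_mult[of _ n])
qed

lemma fdet_lower_triangular:
  assumes "\<And>i j. i < j \<Longrightarrow> j < n \<Longrightarrow> a i j = 0"
  shows "fdet n a = (\<Prod>i<n. a i i)"
proof -
  have "fdet n a = prod_list (diag_mat (mat n n (\<lambda>(i, j). a i j)))"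
    unfolding fdet_def by (rule det_lower_triangular[of n]) (auto simp: assms)
  also have "\<dots> = (\<Prod>i<n. a i i)"
    by (simp add: prod_list_diag_prod atLeast0LessThan)
  finally show ?thesis .
qed

lemma fdet_upper_triangular:
  assumes "\<And>i j. j < i \<Longrightarrow> i < n \<Longrightarrow> a i j = 0"
  shows "fdet n a = (\<Prod>i<n. a i i)"
  using fdet_lower_triangular[of n "\<lambda>i j. a j i"] assms by (simp add: fdet_transpose[of n a])

lemma fdet_mult_row: "fdet n (\<lambda>i j. c i * a i j) = (\<Prod>i<n. c i) * fdet n a"
proof -
  have "fdet n (\<lambda>i j. c i * a i j) = fdet n (\<lambda>i j. if i = j then c i else 0) * fdet n a"
    by (rule fdet_mult) (auto simp: if_distrib[of "\<lambda>x. x * _"] cong: if_cong)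
  also have "fdet n (\<lambda>i j. if i = j then c i else 0) = (\<Prod>i<n. c i)"
    by (subst fdet_lower_triangular) auto
  finally show ?thesis .
qed

lemma fdet_mult_col: "fdet n (\<lambda>i j. c j * a i j) = (\<Prod>j<n. c j) * fdet n a"
  using fdet_mult_row[of n c "\<lambda>i j. a j i"]
  by (simp add: fdet_transpose[of n a] fdet_transpose[of n "\<lambda>i j. c j * a i j"])

section \<open>Vandermonde products and Newton bases\<close>

definition vdm :: "nat \<Rightarrow> (nat \<Rightarrow> 'a) \<Rightarrow> 'a::comm_ring_1" where
  "vdm n w = (\<Prod>j<n. \<Prod>i<j. w j - w i)"

lemma vdm_nonzero: "inj_on w {..<n} \<Longrightarrow> vdm n w \<noteq> (0 :: 'a::idom)"
  by (auto simp: vdm_def inj_on_eq_iff)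

text \<open>Monic polynomial with the listed roots, repetitions allowed. As \<open>k\<close> varies
  these form the Newton basis with nodes \<open>\<phi>\<close>, in which the evaluation matrices
  below become triangular.\<close>

definition newton :: "(nat \<Rightarrow> 'a) \<Rightarrow> nat \<Rightarrow> 'a::comm_ring_1 poly" where
  "newton \<phi> k = (\<Prod>i<k. [:- \<phi> i, 1:])"

lemma poly_newton: "poly (newton \<phi> k) x = (\<Prod>i<k. x - \<phi> i)"
  by (simp add: newton_def poly_prod)

lemma newton_0 [simp]: "newton \<phi> 0 = 1"
  by (simp add: newton_def)

lemma newton_Suc: "newton \<phi> (Suc k) = newton \<phi> k * [:- \<phi> k, 1:]"
  by (simp add: newton_def)

lemma monic_newton [simp]: "lead_coeff (newton \<phi> k :: 'a::idom poly) = 1"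
  by (induction k) (simp_all add: newton_Suc lead_coeff_mult del: mult_pCons_right)

lemma newton_nonzero [simp]: "newton \<phi> k \<noteq> (0 :: 'a::idom poly)"
  using monic_newton[of \<phi> k] by fastforce

lemma degree_newton [simp]: "degree (newton \<phi> k :: 'a::idom poly) = k"
  by (induction k) (simp_all add: newton_Suc degree_mult_eq del: mult_pCons_right)

lemma coeff_newton_same [simp]: "coeff (newton \<phi> k :: 'a::idom poly) k = 1"
  using monic_newton[of \<phi> k] by (simp del: monic_newton)

lemma fdet_poly_coeff:
  assumes "\<And>j. j < n \<Longrightarrow> degree (p j) < n"
  shows "fdet n (\<lambda>i j. poly (p j) (w i)) =
           fdet n (\<lambda>i j. w i ^ j) * fdet n (\<lambda>i j. coeff (p j) i)"
proof (rule fdet_mult)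
  fix i j assume "j < n"
  have "poly (p j) (w i) = (\<Sum>k\<le>degree (p j). coeff (p j) k * w i ^ k)"
    by (rule poly_altdef)
  also have "\<dots> = (\<Sum>k<n. coeff (p j) k * w i ^ k)"
    using assms[OF \<open>j < n\<close>] by (intro sum.mono_neutral_left) (auto simp: coeff_eq_0)
  finally show "poly (p j) (w i) = (\<Sum>k<n. w i ^ k * coeff (p j) k)"
    by (simp add: mult.commute)
qed

lemma fdet_monic:
  assumes "\<And>j. j < n \<Longrightarrow> degree (p j) = j" "\<And>j. j < n \<Longrightarrow> lead_coeff (p j) = 1"
  shows "fdet n (\<lambda>i j. poly (p j) (w i)) = fdet n (\<lambda>i j. w i ^ j)"
proof -
  have "fdet n (\<lambda>i j. coeff (p j) i) = (\<Prod>i<n. coeff (p i) i)"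
    by (rule fdet_upper_triangular) (use assms(1) in \<open>auto simp: coeff_eq_0\<close>)
  also have "\<dots> = 1"
    by (rule prod.neutral) (use assms in fastforce)
  finally show ?thesis
    using assms(1) by (subst fdet_poly_coeff) auto
qed

text \<open>With the evaluation points themselves as Newton nodes the matrix of values is lower
  triangular, and passing from powers to monic polynomials of the same degrees keeps the
  determinant.\<close>

lemma fdet_vandermonde: "fdet n (\<lambda>i j. w i ^ j) = vdm n (w :: nat \<Rightarrow> 'a::idom)"
proof -
  have "fdet n (\<lambda>i j. w i ^ j) = fdet n (\<lambda>i j. poly (newton w j) (w i))"
    by (subst fdet_monic) auto
  also have "\<dots> = (\<Prod>i<n. poly (newton w i) (w i))"
    by (rule fdet_lower_triangular) (auto simp: poly_newton)
  finally show ?thesis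
    by (simp add: poly_newton vdm_def)
qed

lemma fdet_newton:
  "fdet n (\<lambda>i j. poly (newton \<phi> j) (w i)) = vdm n (w :: nat \<Rightarrow> 'a::idom)"
  by (subst fdet_monic) (auto simp: fdet_vandermonde)

text \<open>Repeated synthetic division at \<open>\<phi> j\<close>, \<open>\<phi> (Suc j)\<close>
  and so on: a multiple of \<open>newton \<phi> j\<close> needs no earlier basis element, and the
  first remainder is \<open>poly q (\<phi> j)\<close>. For \<open>j = n\<close> the degree bound
  forces \<open>q = 0\<close> and the sum is empty.\<close>

lemma newton_expansion:
  fixes q :: "'a::idom poly"
  assumes "j \<le> n" "degree (q * newton \<phi> j) < n"
  shows "\<exists>c. q * newton \<phi> j = (\<Sum>k\<in>{j..<n}. smult (c k) (newton \<phi> k)) \<and>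
             (j < n \<longrightarrow> c j = poly q (\<phi> j))"
  using assms
proof (induction "n - j" arbitrary: j q)
  case 0
  then have "q = 0"
    using degree_mult_eq[of q "newton \<phi> j"] by (cases "q = 0") auto
  with 0 show ?case by auto
next
  case (Suc d)
  then have "j < n" by auto
  define q' where "q' = synthetic_div q (\<phi> j)"
  have q: "q = [:poly q (\<phi> j):] + [:- \<phi> j, 1:] * q'"
    using synthetic_div_correct'[of "\<phi> j" q] by (simp add: q'_def add.commute)
  have q2: "q * newton \<phi> j = smult (poly q (\<phi> j)) (newton \<phi> j) + q' * newton \<phi> (Suc j)"
    by (subst q) (simp add: newton_Suc algebra_simps)
  have "degree (q' * newton \<phi> (Suc j)) < n"
  proof -
    have "q' * newton \<phi> (Suc j) = q * newton \<phi> j - smult (poly q (\<phi> j)) (newton \<phi> j)"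
      using q2 by simp
    also have "degree \<dots> < n"
      by (rule degree_diff_less) (use Suc.prems \<open>j < n\<close> in \<open>auto intro: le_less_trans[OF degree_smult_le]\<close>)
    finally show ?thesis .
  qed
  then obtain c where c: "q' * newton \<phi> (Suc j) = (\<Sum>k\<in>{Suc j..<n}. smult (c k) (newton \<phi> k))"
    using Suc.hyps(1)[of "Suc j" q'] Suc.hyps(2) \<open>j < n\<close>
    by (metis Suc_diff_Suc Suc_inject Suc_leI)
  define c' where "c' = c(j := poly q (\<phi> j))"
  have "(\<Sum>k\<in>{Suc j..<n}. smult (c k) (newton \<phi> k)) = (\<Sum>k\<in>{Suc j..<n}. smult (c' k) (newton \<phi> k))"
    by (rule sum.cong) (auto simp: c'_def)
  then have "q * newton \<phi> j = (\<Sum>k\<in>{j..<n}. smult (c' k) (newton \<phi> k))"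
    using \<open>j < n\<close> by (simp add: q2 c sum.atLeast_Suc_lessThan[of j n] c'_def)
  then show ?case
    by (intro exI[of _ c']) (auto simp: c'_def)
qed

text \<open>By \<open>newton_expansion\<close> the passage from the Newton basis to these multiples
  is lower triangular with diagonal \<open>poly (q j) (\<phi> j)\<close>.\<close>

lemma fdet_newton_multiples:
  fixes q :: "nat \<Rightarrow> 'a::idom poly"
  assumes "\<And>j. j < n \<Longrightarrow> degree (q j * newton \<phi> j) < n"
  shows "fdet n (\<lambda>i j. poly (q j * newton \<phi> j) (w i)) = vdm n w * (\<Prod>j<n. poly (q j) (\<phi> j))"
proof -
  have "\<exists>c. q j * newton \<phi> j = (\<Sum>k\<in>{j..<n}. smult (c k) (newton \<phi> k)) \<and> c j = poly (q j) (\<phi> j)"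
    if "j < n" for j
    using newton_expansion[of j n "q j" \<phi>] assms[OF that] that by auto
  then obtain c where c: "\<And>j. j < n \<Longrightarrow> q j * newton \<phi> j = (\<Sum>k\<in>{j..<n}. smult (c j k) (newton \<phi> k))"
      "\<And>j. j < n \<Longrightarrow> c j j = poly (q j) (\<phi> j)"
    by metis
  have "fdet n (\<lambda>i j. poly (q j * newton \<phi> j) (w i)) =
        fdet n (\<lambda>i k. poly (newton \<phi> k) (w i)) * fdet n (\<lambda>k j. if j \<le> k then c j k else 0)"
  proof (rule fdet_mult)
    fix i j assume "j < n"
    have "poly (q j * newton \<phi> j) (w i) = (\<Sum>k\<in>{j..<n}. c j k * poly (newton \<phi> k) (w i))"
      unfolding c(1)[OF \<open>j < n\<close>] by (simp add: poly_sum)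
    also have "\<dots> = (\<Sum>k<n. poly (newton \<phi> k) (w i) * (if j \<le> k then c j k else 0))"
      by (rule sum.mono_neutral_cong_left) auto
    finally show "poly (q j * newton \<phi> j) (w i) =
        (\<Sum>k<n. poly (newton \<phi> k) (w i) * (if j \<le> k then c j k else 0))" .
  qed
  also have "fdet n (\<lambda>k j. if j \<le> k then c j k else 0) = (\<Prod>j<n. poly (q j) (\<phi> j))"
    by (subst fdet_lower_triangular) (auto simp: c(2))
  finally show ?thesis
    by (simp add: fdet_newton)
qed

text \<open>A Sylvester determinant seen through values at the points \<open>w\<close>: apart from
  the Vandermonde factor it is the resultant of \<open>newton \<phi> n\<close> and \<open>G\<close>.
  A unitriangular column operation replaces \<open>w i ^ j\<close> in the first half by the value of
  \<open>newton \<phi> j\<close>, which reduces the claim to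
  \<open>fdet_newton_multiples\<close>.\<close>

lemma fdet_sylvester:
  fixes G :: "'a::idom poly"
  assumes "degree G \<le> n"
  shows "fdet (2 * n) (\<lambda>i j. if j < n then poly G (w i) * w i ^ j
                         else poly (newton \<phi> n) (w i) * w i ^ (j - n)) =
         vdm (2 * n) w * (\<Prod>k<n. poly G (\<phi> k))"
    (is "fdet _ ?a = _")
proof -
  \<comment> \<open>Padding the nodes with zeros turns \<open>newton \<phi> n\<close> times a power
    of the variable into a Newton polynomial, so the second half of the columns fits the same
    pattern with cofactor 1.\<close>
  define \<psi> where "\<psi> k = (if k < n then \<phi> k else 0)" for k
  define q where "q j = (if j < n then G else 1)" for j
  have N1: "newton \<psi> j = newton \<phi> j" if "j \<le> n" for j
    unfolding newton_def by (rule prod.cong) (use that in \<open>auto simp: \<psi>_def\<close>)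
  have N2: "newton \<psi> (n + d) = newton \<phi> n * monom 1 d" for d
  proof (induction d)
    case (Suc d)
    then show ?case
      by (simp add: newton_Suc \<psi>_def monom_Suc)
  qed (simp add: N1)
  let ?c = "\<lambda>k j. if j < n then coeff (newton \<phi> j) k else if k = j then 1 else 0"
  have "fdet (2 * n) (\<lambda>i j. poly (q j * newton \<psi> j) (w i)) = fdet (2 * n) ?a * fdet (2 * n) ?c"
  proof (rule fdet_mult)
    fix i j assume "j < 2 * n"
    show "poly (q j * newton \<psi> j) (w i) = (\<Sum>k<2 * n. ?a i k * ?c k j)"
    proof (cases "j < n")
      case True
      have "poly (newton \<phi> j) (w i) = (\<Sum>k\<le>j. coeff (newton \<phi> j) k * w i ^ k)"
        by (simp add: poly_altdef)
      also have "\<dots> = (\<Sum>k<n. coeff (newton \<phi> j) k * w i ^ k)"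
        using True by (intro sum.mono_neutral_left) (auto simp: coeff_eq_0)
      finally have "poly (q j * newton \<psi> j) (w i) = (\<Sum>k<n. ?a i k * ?c k j)"
        using True by (simp add: q_def N1 sum_distrib_left mult_ac)
      also have "\<dots> = (\<Sum>k<2 * n. ?a i k * ?c k j)"
        using True by (intro sum.mono_neutral_left) (auto simp: coeff_eq_0)
      finally show ?thesis .
    next
      case False
      then have "(\<Sum>k<2 * n. ?a i k * ?c k j) = (\<Sum>k<2 * n. if k = j then ?a i k else 0)"
        by (intro sum.cong) auto
      also have "\<dots> = ?a i j"
        using \<open>j < 2 * n\<close> by simp
      finally show ?thesis
        using False N2[of "j - n"] by (simp add: q_def poly_monom)
    qed
  qed
  moreover have "fdet (2 * n) ?c = 1"
  proof -
    have "fdet (2 * n) ?c = (\<Prod>k<2 * n. ?c k k)"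
      by (rule fdet_upper_triangular) (auto simp: coeff_eq_0)
    also have "\<dots> = 1"
      using monic_newton[of \<phi>] by (intro prod.neutral) (auto simp: degree_newton)
    finally show ?thesis .
  qed
  moreover have "fdet (2 * n) (\<lambda>i j. poly (q j * newton \<psi> j) (w i)) =
      vdm (2 * n) w * (\<Prod>j<2 * n. poly (q j) (\<psi> j))"
  proof (rule fdet_newton_multiples)
    fix j assume "j < 2 * n"
    then show "degree (q j * newton \<psi> j) < 2 * n"
      using degree_mult_le[of "q j" "newton \<psi> j"] assms by (auto simp: q_def)
  qed
  moreover have "(\<Prod>j<2 * n. poly (q j) (\<psi> j)) = (\<Prod>k<n. poly G (\<phi> k))"
    by (rule prod.mono_neutral_cong_right) (auto simp: q_def \<psi>_def)
  ultimately show ?thesis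
    by simp
qed

section \<open>Column operations and Bezoutians\<close>

text \<open>A matrix as a list of columns, each a function of the row index; moving columns then
  becomes list manipulation open to induction.\<close>

definition cdet :: "(nat \<Rightarrow> 'a) list \<Rightarrow> 'a::comm_ring_1" where
  "cdet cs = fdet (length cs) (\<lambda>i j. (cs ! j) i)"

lemma cdet_swap: "cdet (as @ x # y # bs) = - cdet (as @ y # x # bs)"
proof -
  let ?k = "length as" and ?n = "length as + (2 + length bs)"
  let ?A = "mat ?n ?n (\<lambda>(i, j). ((as @ y # x # bs) ! j) i)"
  have "mat ?n ?n (\<lambda>(i, j). ((as @ x # y # bs) ! j) i) = swapcols ?k (Suc ?k) ?A"
  proof (rule eq_matI, goal_cases)
    case (1 i j)
    then consider "j < ?k" | "j = ?k" | "j = Suc ?k" | "j > Suc ?k" by linarith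
    then show ?case
      using 1 by cases (simp_all add: nth_append)
  qed auto
  then have "det (mat ?n ?n (\<lambda>(i, j). ((as @ x # y # bs) ! j) i)) = - det ?A"
    by (simp add: det_swapcols[of ?k ?n "Suc ?k"])
  then show ?thesis
    by (simp add: cdet_def fdet_def)
qed

lemma cdet_move: "cdet (as @ x # bs @ cs) = (-1) ^ length bs * cdet (as @ bs @ x # cs)"
proof (induction bs arbitrary: as)
  case (Cons b bs)
  have "cdet (as @ x # (b # bs) @ cs) = - cdet ((as @ [b]) @ x # bs @ cs)"
    by (simp add: cdet_swap[of as x])
  also have "\<dots> = - ((-1) ^ length bs * cdet ((as @ [b]) @ bs @ x # cs))"
    by (subst Cons.IH) simp
  finally show ?case
    by simp
qed simp

lemma cdet_rev: "cdet (as @ rev cs) = (-1) ^ (length cs choose 2) * cdet (as @ cs)"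
proof (induction cs arbitrary: as)
  case (Cons x cs)
  have "cdet (as @ rev (x # cs)) = (-1) ^ length cs * cdet (as @ x # rev cs @ [])"
    by (subst cdet_move) simp
  also have "cdet (as @ x # rev cs @ []) = (-1) ^ (length cs choose 2) * cdet (as @ x # cs)"
    using Cons.IH[of "as @ [x]"] by simp
  finally show ?case
    by (simp add: power_add numeral_2_eq_2)
qed (simp add: numeral_2_eq_2)

lemma fdet_rev_cols: "fdet n (\<lambda>i j. a i (n - Suc j)) = (-1) ^ (n choose 2) * fdet n a"
proof -
  let ?cs = "map (\<lambda>j i. a i j) [0..<n]"
  have "cdet ([] @ rev ?cs) = fdet n (\<lambda>i j. (rev ?cs ! j) i)"
    by (simp add: cdet_def)
  also have "\<dots> = fdet n (\<lambda>i j. a i (n - Suc j))"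
    by (rule fdet_cong) (simp add: rev_nth)
  finally have "fdet n (\<lambda>i j. a i (n - Suc j)) = (-1) ^ (n choose 2) * cdet ?cs"
    unfolding cdet_rev by simp
  also have "cdet ?cs = fdet n (\<lambda>i j. (?cs ! j) i)"
    by (simp add: cdet_def)
  also have "\<dots> = fdet n a"
    by (rule fdet_cong) simp
  finally show ?thesis .
qed

text \<open>Indices descend, matching the order in which \<open>two_staircase\<close> alternates its
  two kinds of parts.\<close>

fun interleave :: "(nat \<Rightarrow> 'b) \<Rightarrow> (nat \<Rightarrow> 'b) \<Rightarrow> nat \<Rightarrow> 'b list" where
  "interleave f g 0 = []"
| "interleave f g (Suc h) = f h # g h # interleave f g h"

lemma length_interleave [simp]: "length (interleave f g h) = 2 * h"
  by (induction h) auto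

text \<open>In the step to \<open>Suc h\<close> the column \<open>g h\<close> crosses
  \<open>2 * h\<close> columns and costs no sign, while \<open>f h\<close> crosses \<open>h\<close>
  columns; these exponents add up to \<open>h choose 2\<close>.\<close>

lemma cdet_interleave:
  "cdet (as @ interleave f g h) =
     (-1) ^ (h choose 2) * cdet (as @ map f [0..<h] @ map g [0..<h])"
proof (induction h arbitrary: as)
  case (Suc h)
  let ?f = "map f [0..<h]" and ?g = "map g [0..<h]"
  have "cdet (as @ interleave f g (Suc h)) = (-1) ^ (h choose 2) * cdet ((as @ [f h]) @ g h # (?f @ ?g) @ [])"
    using Suc.IH[of "as @ [f h, g h]"] by simp
  also have "cdet ((as @ [f h]) @ g h # (?f @ ?g) @ []) = cdet (as @ f h # ?f @ ?g @ [g h])"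
    by (subst cdet_move) simp
  also have "\<dots> = (-1) ^ h * cdet (as @ ?f @ f h # ?g @ [g h])"
    by (subst cdet_move) simp
  finally show ?case
    by (simp add: power_add numeral_2_eq_2 mult_ac)
qed (simp add: numeral_2_eq_2)

text \<open>
  Writing \<open>x - y = (x - \<phi>\<^sub>k) - (y - \<phi>\<^sub>k)\<close> in the \<open>k\<close>-th summand makes the sum telescope. This factors
  the Bezoutian through Newton bases, in which the determinant is triangular, without any
  assumption that the roots \<open>\<phi>\<close> are distinct.
\<close>

lemma bezout_newton:
  fixes \<phi> :: "nat \<Rightarrow> 'a::idom" and g :: "nat \<Rightarrow> 'a"
  defines "F \<equiv> \<lambda>k x. poly (newton \<phi> k) x"
  assumes "m \<le> n"
  shows "(x - y) * (\<Sum>k<m. F k x * ((\<Prod>i\<in>{Suc k..<n}. y - \<phi> i) * (\<Sum>i\<le>k. g i * F i y))) =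
         F m x * (\<Prod>i\<in>{m..<n}. y - \<phi> i) * (\<Sum>i<m. g i * F i y) -
         F n y * (\<Sum>k<m. g k * F k x)"
  using assms(2)
proof (induction m)
  case (Suc m)
  define T where "T k = (\<Prod>i\<in>{k..<n}. y - \<phi> i)" for k
  define G where "G k = (\<Sum>i<k. g i * F i y)" for k
  have T: "T m = (y - \<phi> m) * T (Suc m)"
    unfolding T_def using Suc.prems by (simp add: prod.atLeast_Suc_lessThan)
  have "F n y = (\<Prod>i\<in>{..<m} \<union> {m..<n}. y - \<phi> i)"
    unfolding F_def poly_newton by (rule prod.cong) (use Suc.prems in auto)
  also have "\<dots> = F m y * T m"
    unfolding F_def poly_newton T_def by (rule prod.union_disjoint) auto
  finally have Fn: "F n y = F m y * T m" .
  have FS: "F (Suc m) x = F m x * (x - \<phi> m)"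
    by (simp add: F_def newton_Suc algebra_simps)
  have GS: "G (Suc m) = G m + g m * F m y"
    by (simp add: G_def)
  have "(x - y) * (\<Sum>k<m. F k x * (T (Suc k) * G (Suc k))) =
        F m x * T m * G m - F n y * (\<Sum>k<m. g k * F k x)"
    using Suc by (simp add: T_def G_def lessThan_Suc_atMost)
  then have "(x - y) * (\<Sum>k<Suc m. F k x * (T (Suc k) * G (Suc k))) =
        F (Suc m) x * T (Suc m) * G (Suc m) - F n y * (\<Sum>k<Suc m. g k * F k x)"
    unfolding sum.lessThan_Suc distrib_left FS GS Fn T by (simp add: algebra_simps)
  then show ?case
    by (simp add: T_def G_def lessThan_Suc_atMost)
qed simp

text \<open>By \<open>bezout_newton\<close> the Bezout matrix is a product of two evaluation
  matrices, one in the points \<open>x\<close> and one in the points \<open>y\<close>. The first is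
  a Newton evaluation matrix; the second, after reversing its columns, consists of Newton multiples
  with diagonal values \<open>poly G (\<phi> k)\<close>.\<close>

lemma det_bezout:
  fixes G :: "'a::idom poly"
  assumes "degree G \<le> n"
    and B: "\<And>i j. i < n \<Longrightarrow> j < n \<Longrightarrow> x i \<noteq> y j"
      "\<And>i j. i < n \<Longrightarrow> j < n \<Longrightarrow> (x i - y j) * b i j =
         poly (newton \<phi> n) (x i) * poly G (y j) - poly (newton \<phi> n) (y j) * poly G (x i)"
  shows "fdet n b = (-1) ^ (n choose 2) * vdm n x * vdm n y * (\<Prod>k<n. poly G (\<phi> k))"
proof -
  obtain g where g: "G = (\<Sum>k\<in>{0..<Suc n}. smult (g k) (newton \<phi> k))"
    using newton_expansion[of 0 "Suc n" G \<phi>] assms(1) by auto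
  \<comment> \<open>Truncations of the Newton expansion of \<open>G\<close>. All omitted terms
    vanish at \<open>\<phi> k\<close>, so \<open>H k\<close> and \<open>G\<close> agree
    there.\<close>
  define H where "H k = (\<Sum>i\<le>k. smult (g i) (newton \<phi> i))" for k
  \<comment> \<open>Reversing the nodes turns the tail products over the indices above
    \<open>k\<close> into Newton polynomials.\<close>
  define \<psi> where "\<psi> i = \<phi> (n - Suc i)" for i
  have G: "poly G u = (\<Sum>k<n. g k * poly (newton \<phi> k) u) + g n * poly (newton \<phi> n) u" for u
    by (simp add: g poly_sum atLeast0LessThan)
  have degH: "degree (H k) \<le> k" for k
    unfolding H_def by (rule degree_sum_le) (auto intro: order_trans[OF degree_smult_le])
  have polyH: "poly (H k) u = (\<Sum>i\<le>k. g i * poly (newton \<phi> i) u)" for k u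
    by (simp add: H_def poly_sum)
  have H\<phi>: "poly (H k) (\<phi> k) = poly G (\<phi> k)" if "k < n" for k
  proof -
    have "poly G (\<phi> k) = (\<Sum>i\<le>n. g i * poly (newton \<phi> i) (\<phi> k))"
      by (simp add: G flip: lessThan_Suc_atMost)
    also have "\<dots> = (\<Sum>i\<le>k. g i * poly (newton \<phi> i) (\<phi> k))"
      by (rule sum.mono_neutral_right) (use that in \<open>auto simp: poly_newton\<close>)
    finally show ?thesis by (simp add: polyH)
  qed
  have tail: "poly (newton \<psi> (n - Suc k)) u = (\<Prod>i\<in>{Suc k..<n}. u - \<phi> i)" if "k < n" for k u
    unfolding poly_newton \<psi>_def
    by (rule prod.reindex_bij_witness[of _ "\<lambda>i. n - Suc i" "\<lambda>i. n - Suc i"]) (use that in auto)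
  have "fdet n b = fdet n (\<lambda>i k. poly (newton \<phi> k) (x i)) *
                   fdet n (\<lambda>k j. poly (H k * newton \<psi> (n - Suc k)) (y j))"
  proof (rule fdet_mult)
    fix i j assume ij: "i < n" "j < n"
    have "(x i - y j) * (\<Sum>k<n. poly (newton \<phi> k) (x i) * poly (H k * newton \<psi> (n - Suc k)) (y j)) =
      (x i - y j) * (\<Sum>k<n. poly (newton \<phi> k) (x i) * ((\<Prod>l\<in>{Suc k..<n}. y j - \<phi> l) * 
        (\<Sum>l\<le>k. g l * poly (newton \<phi> l) (y j))))"
      by (intro arg_cong2[of _ _ _ _ "(*)"] sum.cong refl) (simp add: tail polyH)
    \<comment> \<open>The top coefficient \<open>g n\<close> drops out, because its contribution to
      the antisymmetric expression in \<open>B(2)\<close> cancels.\<close>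
    also have "\<dots> = (x i - y j) * b i j"
      unfolding B(2)[OF ij] by (subst bezout_newton) (simp_all add: G algebra_simps)
    finally show "b i j =
        (\<Sum>k<n. poly (newton \<phi> k) (x i) * poly (H k * newton \<psi> (n - Suc k)) (y j))"
      using B(1)[OF ij] by simp
  qed
  also have "fdet n (\<lambda>k j. poly (H k * newton \<psi> (n - Suc k)) (y j)) =
             fdet n (\<lambda>j k. poly (H k * newton \<psi> (n - Suc k)) (y j))"
    by (rule fdet_transpose)
  \<comment> \<open>This reversal, which makes the Newton index increase with the column, is the
    only source of the sign.\<close>
  also have "\<dots> = (-1) ^ (n choose 2) * fdet n (\<lambda>j k. poly (H (n - Suc k) * newton \<psi> k) (y j))"
    by (subst fdet_rev_cols[symmetric], rule fdet_cong) simp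
  also have "fdet n (\<lambda>j k. poly (H (n - Suc k) * newton \<psi> k) (y j)) =
             vdm n y * (\<Prod>k<n. poly (H (n - Suc k)) (\<psi> k))"
  proof (rule fdet_newton_multiples)
    fix k assume "k < n"
    then show "degree (H (n - Suc k) * newton \<psi> k) < n"
      using degree_mult_le[of "H (n - Suc k)" "newton \<psi> k"] degH[of "n - Suc k"] by simp
  qed
  also have "(\<Prod>k<n. poly (H (n - Suc k)) (\<psi> k)) = (\<Prod>k<n. poly (H (n - Suc (n - Suc k))) (\<psi> (n - Suc k)))"
    by (rule prod.nat_diff_reindex[symmetric])
  also have "\<dots> = (\<Prod>k<n. poly G (\<phi> k))"
    by (rule prod.cong) (auto simp: \<psi>_def H\<phi>)
  finally show ?thesis
    by (simp add: fdet_newton)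
qed

section \<open>Linear systems, splitting and roots of unity\<close>

lemma fdet_kernel:
  fixes a :: "nat \<Rightarrow> nat \<Rightarrow> 'a::idom"
  assumes "fdet n a = 0"
  obtains c j where "j < n" "c j \<noteq> 0" "\<And>i. i < n \<Longrightarrow> (\<Sum>j<n. a i j * c j) = 0"
proof -
  let ?A = "mat n n (\<lambda>(i, j). a i j)"
  obtain v where v: "v \<in> carrier_vec n" "v \<noteq> 0\<^sub>v n" "?A *\<^sub>v v = 0\<^sub>v n"
    using det_0_iff_vec_prod_zero[of ?A n] assms by (auto simp: fdet_def)
  then obtain j where "j < n" "v $ j \<noteq> 0"
    by (metis carrier_vecD eq_vecI index_zero_vec)
  moreover have "(\<Sum>j<n. a i j * v $ j) = 0" if "i < n" for i
  proof -
    have "(?A *\<^sub>v v) $ i = (\<Sum>j<n. a i j * v $ j)"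
      using that v(1) by (simp add: scalar_prod_def atLeast0LessThan)
    then show ?thesis using v(3) that by simp
  qed
  ultimately show ?thesis using that by blast
qed

lemma fdet_kernel_trivial:
  fixes a :: "nat \<Rightarrow> nat \<Rightarrow> 'a::idom"
  assumes "fdet n a \<noteq> 0" "\<And>i. i < n \<Longrightarrow> (\<Sum>j<n. a i j * c j) = 0" "j < n"
  shows "c j = 0"
proof -
  let ?A = "mat n n (\<lambda>(i, j). a i j)"
  have "?A *\<^sub>v vec n c = 0\<^sub>v n"
    by (rule eq_vecI) (auto simp: scalar_prod_def atLeast0LessThan assms(2))
  then have "vec n c = 0\<^sub>v n"
    using det_0_iff_vec_prod_zero[of ?A n] assms(1) unfolding fdet_def
    by (metis mat_carrier vec_carrier)
  then show ?thesis
    using assms(3) by (metis index_vec index_zero_vec(1))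
qed

lemma fdet_solve:
  fixes a :: "nat \<Rightarrow> nat \<Rightarrow> 'a::field"
  assumes "fdet n a \<noteq> 0"
  obtains c where "\<And>i. i < n \<Longrightarrow> (\<Sum>j<n. a i j * c j) = v i"
proof -
  let ?A = "mat n n (\<lambda>(i, j). a i j)"
  let ?B = "adj_mat ?A"
  have B: "?B \<in> carrier_mat n n" "?A * ?B = det ?A \<cdot>\<^sub>m 1\<^sub>m n"
    using adj_mat[of ?A n] by auto
  \<comment> \<open>Cramer's rule, expressed through the adjugate matrix.\<close>
  define c where "c j = (\<Sum>k<n. ?B $$ (j, k) * v k) / det ?A" for j
  have "(\<Sum>j<n. a i j * c j) = v i" if "i < n" for i
  proof -
    have AB: "(\<Sum>j<n. a i j * ?B $$ (j, k)) = (if i = k then det ?A else 0)" if "k < n" for k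
    proof -
      have "(?A * ?B) $$ (i, k) = (\<Sum>j<n. a i j * ?B $$ (j, k))"
        using \<open>i < n\<close> \<open>k < n\<close> B(1) by (simp add: scalar_prod_def atLeast0LessThan)
      then show ?thesis
        using B(2) \<open>i < n\<close> \<open>k < n\<close> by (auto split: if_splits)
    qed
    have "(\<Sum>j<n. a i j * c j) * det ?A = (\<Sum>j<n. a i j * (\<Sum>k<n. ?B $$ (j, k) * v k))"
      using assms by (simp add: c_def sum_distrib_right fdet_def)
    also have "\<dots> = (\<Sum>k<n. (\<Sum>j<n. a i j * ?B $$ (j, k)) * v k)"
      unfolding sum_distrib_left sum_distrib_right by (subst sum.swap) (simp add: mult_ac)
    also have "\<dots> = (\<Sum>k<n. if i = k then det ?A * v k else 0)"
      by (rule sum.cong) (auto simp: AB)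
    also have "\<dots> = v i * det ?A"
      using that by simp
    finally show ?thesis
      using assms by (simp add: fdet_def)
  qed
  then show ?thesis using that by blast
qed

lemma fdet_2: "fdet 2 a = a 0 0 * a 1 1 - a 0 1 * (a 1 0 :: 'a::idom)"
proof -
  let ?M = "\<lambda>x. mat 1 1 (\<lambda>_. x) :: 'a mat"
  have "mat 2 2 (\<lambda>(i, j). a i j) = four_block_mat (?M (a 0 0)) (?M (a 0 1)) (?M (a 1 0)) (?M (a 1 1))"
    by (rule eq_matI) (auto simp: numeral_2_eq_2 less_Suc_eq)
  moreover have "?M (a 1 0) * ?M (a 1 1) = ?M (a 1 1) * ?M (a 1 0)"
    by (rule eq_matI) (auto simp: scalar_prod_def)
  ultimately have "fdet 2 a = det (?M (a 0 0) * ?M (a 1 1) - ?M (a 0 1) * ?M (a 1 0))"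
    unfolding fdet_def by (simp add: det_four_block_mat[of _ 1])
  then show ?thesis
    by (subst (asm) det_single) (auto simp: scalar_prod_def)
qed

text \<open>Adding combinations of the first \<open>m\<close> columns to the last two turns these
  into \<open>u\<close> and \<open>v\<close>. Their first \<open>m\<close> entries vanish, so the
  matrix becomes block lower triangular with a 2 by 2 block in the corner.\<close>

lemma fdet_border:
  fixes a :: "nat \<Rightarrow> nat \<Rightarrow> 'a::idom"
  assumes u: "\<And>i. u i = a i m + (\<Sum>j<m. a i j * \<alpha> j)"
    and v: "\<And>i. v i = a i (Suc m) + (\<Sum>j<m. a i j * \<beta> j)"
    and uv0: "\<And>i. i < m \<Longrightarrow> u i = 0" "\<And>i. i < m \<Longrightarrow> v i = 0"
  shows "fdet (m + 2) a = fdet m a * (u m * v (Suc m) - v m * u (Suc m))"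
proof -
  define a' where "a' i j = (if j = m then u i else if j = Suc m then v i else a i j)" for i j
  define T where "T k j = (if k = j then 1 else if k < m \<and> j = m then \<alpha> k
    else if k < m \<and> j = Suc m then \<beta> k else 0)" for k j
  have "fdet (m + 2) a' = fdet (m + 2) a * fdet (m + 2) T"
  proof (rule fdet_mult)
    fix i j assume "j < m + 2"
    then consider "j < m" | "j = m" | "j = Suc m" by linarith
    then show "a' i j = (\<Sum>k<m + 2. a i k * T k j)"
    proof cases
      case 1
      then have "(\<Sum>k<m + 2. a i k * T k j) = (\<Sum>k<m + 2. if k = j then a i k else 0)"
        by (intro sum.cong) (auto simp: T_def)
      then show ?thesis using 1 by (simp add: a'_def)
    next
      case 2
      have "(\<Sum>k<m. a i k * T k j) = (\<Sum>k<m. a i k * \<alpha> k)"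
        by (rule sum.cong) (auto simp: T_def 2)
      then show ?thesis using 2 by (simp add: a'_def u T_def)
    next
      case 3
      have "(\<Sum>k<m. a i k * T k j) = (\<Sum>k<m. a i k * \<beta> k)"
        by (rule sum.cong) (auto simp: T_def 3)
      then show ?thesis using 3 by (simp add: a'_def v T_def)
    qed
  qed
  moreover have "fdet (m + 2) T = 1"
    by (subst fdet_upper_triangular) (auto simp: T_def)
  moreover have "fdet (m + 2) a' = fdet m a * fdet 2 (\<lambda>i j. a' (m + i) (m + j))"
  proof -
    have "mat (m + 2) (m + 2) (\<lambda>(i, j). a' i j) =
        four_block_mat (mat m m (\<lambda>(i, j). a i j)) (0\<^sub>m m 2)
          (mat 2 m (\<lambda>(i, j). a (m + i) j)) (mat 2 2 (\<lambda>(i, j). a' (m + i) (m + j)))"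
      by (rule eq_matI) (auto simp: a'_def uv0)
    then show ?thesis
      unfolding fdet_def by (simp add: det_four_block_mat_upper_right_zero[of _ m _ 2])
  qed
  ultimately show ?thesis
    by (simp add: fdet_2 a'_def)
qed

section \<open>Factoring polynomials through their roots\<close>

lemma newton_dvd:
  fixes f :: "'a::idom poly"
  assumes "inj_on z {..<m}" "\<And>i. i < m \<Longrightarrow> poly f (z i) = 0"
  shows "newton z m dvd f"
  using assms
proof (induction m)
  case (Suc m)
  then have "newton z m dvd f"
    by (simp add: inj_on_subset[OF Suc.prems(1)] subset_eq)
  then obtain q where q: "f = newton z m * q" by auto
  have "poly (newton z m) (z m) \<noteq> 0"
    by (auto simp: poly_newton inj_on_eq_iff[OF Suc.prems(1)])
  then have "poly q (z m) = 0"
    using Suc.prems(2)[of m] by (simp add: q)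
  then have "[:- z m, 1:] dvd q"
    by (simp add: poly_eq_0_iff_dvd)
  then show ?case
    unfolding q newton_Suc by (rule mult_dvd_mono[OF dvd_refl])
qed simp

lemma monic_eq_newton:
  fixes f :: "'a::idom poly"
  assumes "inj_on z {..<m}" "\<And>i. i < m \<Longrightarrow> poly f (z i) = 0" "degree f = m" "lead_coeff f = 1"
  shows "f = newton z m"
proof -
  obtain q where q: "f = newton z m * q"
    using newton_dvd[OF assms(1,2)] by auto
  have "q \<noteq> 0" using assms(4) q by auto
  then have "degree q = 0"
    using assms(3) degree_mult_eq[of "newton z m" q] by (simp add: q)
  then obtain c where "q = [:c:]"
    by (rule degree_eq_zeroE)
  moreover have "c = 1"
    using assms(4) unfolding q lead_coeff_mult monic_newton by (simp add: \<open>q = [:c:]\<close>)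
  ultimately show ?thesis by (simp add: q)
qed

lemma alg_closed_newton:
  fixes f :: "'a::alg_closed_field poly"
  assumes "lead_coeff f = 1"
  obtains \<phi> where "f = newton \<phi> (degree f)"
proof -
  have "f \<noteq> 0" using assms by auto
  then obtain A where A: "size A = degree f" "f = smult (lead_coeff f) (\<Prod>x\<in>#A. [:- x, 1:])"
    using alg_closed_imp_factorization by blast
  obtain xs where xs: "A = mset xs"
    by (metis ex_mset)
  have "f = prod_list (map (\<lambda>x. [:- x, 1:]) xs)"
    using A(2) assms by (simp add: xs prod_mset_prod_list flip: mset_map)
  also have "\<dots> = newton ((!) xs) (length xs)"
    by (simp add: newton_def prod.list_conv_set_nth atLeast0LessThan)
  finally show ?thesis
    using A(1) that by (simp add: xs)
qed

text \<open>Lists the \<open>r\<close>-th roots of \<open>t\<close> with multiplicity, so that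
  \<open>t = 0\<close> needs no separate treatment.\<close>

lemma newton_eq_monom:
  fixes t :: "'a::alg_closed_field"
  assumes "r > 0"
  obtains \<eta> where "newton \<eta> r = monom 1 r - [:t:]"
proof -
  have deg: "degree (monom 1 r - [:t:]) = r"
    unfolding diff_conv_add_uminus by (subst degree_add_eq_left) (use assms in \<open>auto simp: degree_monom_eq\<close>)
  have "lead_coeff (monom 1 r - [:t:]) = 1"
    unfolding deg using assms by (simp add: coeff_pCons split: nat.split)
  then show ?thesis
    using alg_closed_newton[of "monom 1 r - [:t:]"] that deg by metis
qed

section \<open>Roots of unity\<close>

definition unity_roots :: "nat \<Rightarrow> 'a::field set" where
  "unity_roots r = {\<zeta>. \<zeta> ^ r = 1}"

lemma prod_unity_roots_one:
  fixes x :: "'a::{alg_closed_field, field_char_0}"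
  assumes "r > 0"
  shows "(\<Prod>\<zeta>\<in>unity_roots r. x - \<zeta>) = x ^ r - 1" "card (unity_roots r :: 'a set) = r"
    "finite (unity_roots r :: 'a set)"
proof -
  obtain \<eta> :: "nat \<Rightarrow> 'a" where \<eta>: "newton \<eta> r = monom 1 r - [:1:]"
    using newton_eq_monom[OF assms] by metis
  have ev: "(\<Prod>i<r. x - \<eta> i) = x ^ r - 1" for x
    using arg_cong[OF \<eta>, of "\<lambda>q. poly q x"] by (simp add: poly_newton poly_monom)
  have img: "unity_roots r = \<eta> ` {..<r}"
  proof -
    have "x ^ r = 1 \<longleftrightarrow> x \<in> \<eta> ` {..<r}" for x
    proof -
      have "x ^ r = 1 \<longleftrightarrow> (\<Prod>i<r. x - \<eta> i) = 0"
        by (simp add: ev)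
      then show ?thesis
        by auto
    qed
    then show ?thesis by (auto simp: unity_roots_def)
  qed
  \<comment> \<open>Separability in characteristic zero: a repeated root would also be a root of the
    derivative \<open>r * x ^ (r - 1)\<close>, but roots of unity are nonzero.\<close>
  have inj: "inj_on \<eta> {..<r}"
  proof (rule inj_onI, rule ccontr)
    fix i j assume ij: "i \<in> {..<r}" "j \<in> {..<r}" "\<eta> i = \<eta> j" "i \<noteq> j"
    define L q where "L = [:- \<eta> i, 1:]" and "q = (\<Prod>k\<in>{..<r} - {i} - {j}. [:- \<eta> k, 1:])"
    have "newton \<eta> r = L * (L * q)"
      unfolding newton_def L_def q_def using ij
      by (simp add: prod.remove[of "{..<r}" i] prod.remove[of "{..<r} - {i}" j] del: mult_pCons_left)
    moreover have "poly L (\<eta> i) = 0"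
      by (simp add: L_def)
    ultimately have "poly (pderiv (newton \<eta> r)) (\<eta> i) = 0"
      by (simp add: pderiv_mult)
    moreover have "poly (pderiv (newton \<eta> r)) (\<eta> i) = of_nat r * \<eta> i ^ (r - 1)"
      by (simp add: \<eta> pderiv_diff pderiv_monom poly_monom pderiv_pCons)
    moreover have "\<eta> i ^ r = 1"
      using ij(1) img by (auto simp: unity_roots_def)
    ultimately show False
      using assms by (auto simp: power_0_left)
  qed
  show "(\<Prod>\<zeta>\<in>unity_roots r. x - \<zeta>) = x ^ r - 1"
    using inj ev by (simp add: img prod.reindex)
  show "card (unity_roots r :: 'a set) = r"
    using inj by (simp add: img card_image)
  show "finite (unity_roots r :: 'a set)"
    by (simp add: img)
qed

lemma prod_unity_roots:
  fixes x y :: "'a::{alg_closed_field, field_char_0}"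
  assumes "r > 0"
  shows "(\<Prod>\<zeta>\<in>unity_roots r. x - \<zeta> * y) = x ^ r - y ^ r"
proof (cases "y = 0")
  case True
  then show ?thesis
    using assms by (simp add: prod_unity_roots_one)
next
  case False
  have "(\<Prod>\<zeta>\<in>unity_roots r. x - \<zeta> * y) = (\<Prod>\<zeta>\<in>unity_roots r. y * (x / y - \<zeta>))"
    using False by (intro prod.cong) (auto simp: field_simps)
  also have "\<dots> = y ^ r * ((x / y) ^ r - 1)"
    using assms by (simp add: prod.distrib prod_unity_roots_one)
  finally show ?thesis
    using False by (simp add: power_divide right_diff_distrib)
qed

lemma one_unity_root [simp]: "1 \<in> unity_roots r"
  by (simp add: unity_roots_def)

lemma prod_nontrivial_unity_roots:
  fixes x y :: "'a::{alg_closed_field, field_char_0}"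
  assumes "r > 0" "x \<noteq> y"
  shows "(\<Prod>\<zeta>\<in>unity_roots r - {1}. x - \<zeta> * y) = (x ^ r - y ^ r) / (x - y)"
  using prod_unity_roots[OF assms(1), of x y] assms
  by (simp add: prod.remove[of _ 1] prod_unity_roots_one field_simps)

text \<open>If \<open>p\<close> is prime to \<open>r\<close>, the \<open>p\<close>-th power map
  permutes the nontrivial \<open>r\<close>-th roots of unity. Otherwise a nontrivial root of unity
  of order dividing \<open>gcd p r\<close> makes one factor vanish.\<close>

lemma prod_unity_roots_power_minus_one:
  assumes "r > 0" "p > 0"
  shows "(\<Prod>\<zeta>\<in>unity_roots r - {1}. \<zeta> ^ p - 1) =
    (if coprime p r then (\<Prod>\<zeta>\<in>unity_roots r - {1}. \<zeta> - 1)
     else (0 :: 'a::{alg_closed_field, field_char_0}))"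
proof (cases "coprime p r")
  case True
  \<comment> \<open>An inverse of \<open>p\<close> modulo \<open>r\<close>: the \<open>q\<close>-th
    power map undoes the \<open>p\<close>-th power map.\<close>
  then obtain q k where "p * q = r * k + 1"
    using bezout_nat[of p r] assms by auto
  then have qk: "q * p = k * r + 1"
    by (simp add: mult.commute)
  have inv: "(\<zeta> ^ p) ^ q = \<zeta>" "(\<zeta> ^ q) ^ p = \<zeta>" if "\<zeta> \<in> unity_roots r" for \<zeta> :: 'a
  proof -
    have "\<zeta> ^ (q * p) = (\<zeta> ^ r) ^ k * \<zeta>"
      unfolding qk by (simp add: power_add mult.commute flip: power_mult)
    then have "\<zeta> ^ (q * p) = \<zeta>"
      using that by (simp add: unity_roots_def)
    then show "(\<zeta> ^ p) ^ q = \<zeta>" "(\<zeta> ^ q) ^ p = \<zeta>"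
      by (simp_all add: mult.commute flip: power_mult)
  qed
  have closed: "\<zeta> ^ e \<in> unity_roots r" if "\<zeta> \<in> unity_roots r" for \<zeta> :: 'a and e
    using that by (simp add: unity_roots_def) (metis power_commutes power_mult power_one mult.commute)
  have "(\<Prod>\<zeta>\<in>unity_roots r - {1}. \<zeta> ^ p - 1) = (\<Prod>\<zeta>\<in>unity_roots r - {1}. \<zeta> - (1::'a))"
    by (rule prod.reindex_bij_witness[of _ "\<lambda>\<zeta>. \<zeta> ^ q" "\<lambda>\<zeta>. \<zeta> ^ p"])
       (auto simp: inv closed dest: arg_cong[of _ 1 "\<lambda>x. x ^ q"] arg_cong[of _ 1 "\<lambda>x. x ^ p"])
  then show ?thesis using True by simp
next
  case False
  define d where "d = gcd p r"
  have "d > 1"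
    using False assms(1) gcd_pos_nat[of p r] unfolding d_def coprime_iff_gcd_eq_1 by linarith
  have "card (unity_roots d :: 'a set) = d"
    using \<open>d > 1\<close> by (simp add: prod_unity_roots_one)
  then have "unity_roots d \<noteq> {1 :: 'a}"
    using \<open>d > 1\<close> by auto
  then obtain \<zeta> :: 'a where \<zeta>: "\<zeta> ^ d = 1" "\<zeta> \<noteq> 1"
    using one_unity_root[of d] by (auto simp: unity_roots_def)
  have "\<zeta> ^ e = 1" if "d dvd e" for e
    using that \<zeta>(1) by (auto simp: power_mult)
  then have "\<zeta> ^ p = 1" "\<zeta> ^ r = 1"
    by (auto simp: d_def)
  then have "\<exists>\<zeta>\<in>unity_roots r - {1 :: 'a}. \<zeta> ^ p - 1 = 0"
    using \<zeta>(2) by (auto simp: unity_roots_def)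
  then show ?thesis
    using False assms by (simp add: prod_unity_roots_one)
qed

lemma prod_offdiagonal:
  fixes c :: "nat \<Rightarrow> nat \<Rightarrow> 'a::comm_monoid_mult"
  shows "(\<Prod>i<n. \<Prod>j\<in>{..<n} - {i}. c i j) = (\<Prod>j<n. \<Prod>i<j. c i j * c j i)"
proof (induction n)
  case (Suc n)
  have "(\<Prod>j\<in>{..<Suc n} - {i}. c i j) = c i n * (\<Prod>j\<in>{..<n} - {i}. c i j)" if "i < n" for i
  proof -
    have "{..<Suc n} - {i} = insert n ({..<n} - {i})"
      using that by auto
    then show ?thesis by simp
  qed
  moreover have "{..<Suc n} - {n} = {..<n}"
    by auto
  ultimately show ?case
    by (simp add: Suc.IH prod.distrib mult_ac)
qed simp

section \<open>The pencil of functions vanishing at the given points\<close>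

lemma prod_diff_swap: "(\<Prod>k<n. f k - x) = (-1) ^ n * (\<Prod>k<n. x - f k :: 'a::comm_ring_1)"
  by (induction n) (simp_all add: algebra_simps)

lemma sum_lessThan_add:
  fixes m n :: nat
  shows "(\<Sum>j<m + n. f j) = (\<Sum>j<m. f j) + (\<Sum>j<n. f (m + j) :: 'a::comm_monoid_add)"
  by (induction n) (simp_all add: add.assoc)

lemma poly_eq_sum_coeffs:
  fixes q :: "'a::comm_ring_1 poly"
  assumes "\<And>k. n \<le> k \<Longrightarrow> coeff q k = 0"
  shows "poly q x = (\<Sum>k<n. coeff q k * x ^ k)"
proof -
  have "poly q x = (\<Sum>k\<in>{..degree q} \<union> {..<n}. coeff q k * x ^ k)"
    unfolding poly_altdef by (rule sum.mono_neutral_left) (auto simp: coeff_eq_0)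
  also have "\<dots> = (\<Sum>k<n. coeff q k * x ^ k)"
    by (rule sum.mono_neutral_right) (auto simp: assms)
  finally show ?thesis .
qed

text \<open>For \<open>r = l + 2\<close> and \<open>p = l' + 1\<close> this is the numerator of the
  Schur polynomial of \<open>two_staircase k l l'\<close>: adding the staircase shift to the parts
  gives the exponents \<open>k * r + p\<close> and \<open>k * r\<close>.\<close>

definition alternant :: "nat \<Rightarrow> nat \<Rightarrow> nat \<Rightarrow> (nat \<Rightarrow> 'a) \<Rightarrow> 'a::comm_ring_1" where
  "alternant r p k w = cdet (interleave (\<lambda>k i. w i ^ (k * r + p)) (\<lambda>k i. w i ^ (k * r)) k)"

text \<open>
  The sign turns the increasing Vandermonde product \<open>vdm\<close> of \<open>2 k\<close> points into the decreasing one in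
  the denominator of \<open>schur\<close>, as \<open>k\<close> and \<open>2 k choose 2\<close> have the same parity.
\<close>

definition schur2 :: "nat \<Rightarrow> nat \<Rightarrow> nat \<Rightarrow> (nat \<Rightarrow> 'a) \<Rightarrow> 'a::field" where
  "schur2 r p k w = alternant r p k w / ((-1) ^ k * vdm (2 * k) w)"

text \<open>
  Genericity: a polynomial with at most \<open>k\<close> terms that vanishes at \<open>k\<close> of the points is zero.
\<close>

locale generic_points =
  fixes h r p :: nat and z :: "nat \<Rightarrow> 'a::{alg_closed_field, field_char_0}"
  assumes p_pos: "0 < p" and p_less: "p < r"
    and generic: "\<And>S I c e. \<lbrakk>finite S; I \<subseteq> {..<2 * h}; card S \<le> card I;
      \<And>i. i \<in> I \<Longrightarrow> (\<Sum>e\<in>S. c e * z i ^ e) = 0; e \<in> S\<rbrakk> \<Longrightarrow> c e = 0"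
begin

lemma r_pos: "r > 0"
  using p_less by simp

lemma z_nonzero: "i < 2 * h \<Longrightarrow> z i \<noteq> 0"
  using generic[of "{1}" "{i}" "\<lambda>_. 1" 1] by auto

lemma inj_powers: "inj_on (\<lambda>i. z i ^ r) {..<2 * h}"
proof (rule inj_onI, rule ccontr)
  fix i j assume ij: "i \<in> {..<2 * h}" "j \<in> {..<2 * h}" "z i ^ r = z j ^ r" "i \<noteq> j"
  \<comment> \<open>Genericity applied to the binomial \<open>x ^ r - z i ^ r\<close>, which has two
    terms and vanishes at the two points; the claim is that its coefficient at exponent
    \<open>r\<close> is zero.\<close>
  have "(if r = 0 then - (z i ^ r) else 1) = 0"
    by (rule generic[of "{0, r}" "{i, j}"]) (use ij r_pos in auto)
  then show False using r_pos by simp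
qed

lemma inj_z: "inj_on z {..<2 * h}"
  using inj_powers by (auto simp: inj_on_def)

text \<open>Since \<open>0 < p < r\<close>, the exponents coming from \<open>a\<close> and from
  \<open>b\<close> lie in different residue classes modulo \<open>r\<close>. The pair is thus a
  polynomial with at most \<open>na + nb\<close> terms whose coefficients can be read off, and
  genericity applies.\<close>

lemma generic_pair:
  assumes a: "\<And>k. na \<le> k \<Longrightarrow> coeff a k = 0" and b: "\<And>k. nb \<le> k \<Longrightarrow> coeff b k = 0"
    and I: "I \<subseteq> {..<2 * h}" "na + nb \<le> card I"
    and zero: "\<And>i. i \<in> I \<Longrightarrow> poly a (z i ^ r) + z i ^ p * poly b (z i ^ r) = 0"
  shows "a = 0" "b = 0"
proof -
  define S where "S = (\<lambda>k. k * r) ` {..<na} \<union> (\<lambda>k. k * r + p) ` {..<nb}"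
  \<comment> \<open>The residue of the exponent modulo \<open>r\<close> tells which of the two
    polynomials a coefficient belongs to.\<close>
  define c where "c e = (if e mod r = 0 then coeff a (e div r) else coeff b (e div r))" for e
  have ca: "c (k * r) = coeff a k" and cb: "c (k * r + p) = coeff b k" for k
    using p_pos p_less by (auto simp: c_def)
  have disj: "(\<lambda>k. k * r) ` {..<na} \<inter> (\<lambda>k. k * r + p) ` {..<nb} = {}"
  proof -
    have "(k * r) mod r \<noteq> (k' * r + p) mod r" for k k'
      using p_pos p_less by simp
    then have "k * r \<noteq> k' * r + p" for k k'
      by metis
    then show ?thesis by auto
  qed
  have "(\<Sum>e\<in>S. c e * z i ^ e) = poly a (z i ^ r) + z i ^ p * poly b (z i ^ r)" for i
  proof -
    have "(\<Sum>e\<in>S. c e * z i ^ e) =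
        (\<Sum>k<na. coeff a k * z i ^ (k * r)) + (\<Sum>k<nb. coeff b k * z i ^ (k * r + p))"
      unfolding S_def using r_pos
      by (subst sum.union_disjoint[OF _ _ disj]) (auto simp: sum.reindex inj_on_def ca cb)
    also have "\<dots> = poly a (z i ^ r) + z i ^ p * poly b (z i ^ r)"
      by (simp add: poly_eq_sum_coeffs[of na a, OF a] poly_eq_sum_coeffs[of nb b, OF b])
         (simp add: sum_distrib_left power_add mult_ac flip: power_mult)
    finally show ?thesis .
  qed
  then have sum0: "(\<Sum>e\<in>S. c e * z i ^ e) = 0" if "i \<in> I" for i
    using zero[OF that] by simp
  have "card S \<le> na + nb"
    unfolding S_def using card_image_le[of "{..<na}"] card_image_le[of "{..<nb}"]
    by (metis (no_types, lifting) add_mono card_Un_le card_lessThan finite_lessThan le_trans)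
  then have "card S \<le> card I"
    using I(2) by simp
  then have c0: "c e = 0" if "e \<in> S" for e
    using generic[of S I c e] I(1) sum0 that by (auto simp: S_def)
  have "coeff a k = 0" for k
    using c0[of "k * r"] ca[of k] a[of k] by (cases "k < na") (auto simp: S_def)
  then show "a = 0" by (simp add: poly_eq_iff)
  have "coeff b k = 0" for k
    using c0[of "k * r + p"] cb[of k] b[of k] by (cases "k < nb") (auto simp: S_def)
  then show "b = 0" by (simp add: poly_eq_iff)
qed

text \<open>The columns of \<open>alternant r p h\<close>, regrouped by residue class as in
  \<open>cdet_interleave\<close>.\<close>

definition basis :: "nat \<Rightarrow> 'a \<Rightarrow> 'a" where
  "basis j x = (if j < h then x ^ (j * r + p) else x ^ ((j - h) * r))"

lemma basis_combination:
  obtains a b where "\<And>k. h \<le> k \<Longrightarrow> coeff a k = 0" "\<And>k. h \<le> k \<Longrightarrow> coeff b k = 0"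
    "\<And>x. (\<Sum>j<2 * h. basis j x * c j) = poly a (x ^ r) + x ^ p * poly b (x ^ r)"
    "\<And>k. k < h \<Longrightarrow> coeff a k = c (h + k)" "\<And>k. k < h \<Longrightarrow> coeff b k = c k"
proof -
  define a b where "a = (\<Sum>k<h. monom (c (h + k)) k)" and "b = (\<Sum>k<h. monom (c k) k)"
  have ca: "coeff a k = (if k < h then c (h + k) else 0)"
    and cb: "coeff b k = (if k < h then c k else 0)" for k
    by (simp_all add: a_def b_def coeff_sum)
  have "(\<Sum>j<2 * h. basis j x * c j) = poly a (x ^ r) + x ^ p * poly b (x ^ r)" for x
  proof -
    have "(\<Sum>j<2 * h. basis j x * c j) =
        (\<Sum>j<h. x ^ (j * r + p) * c j) + (\<Sum>j<h. x ^ (j * r) * c (h + j))"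
      unfolding mult_2 sum_lessThan_add by (simp add: basis_def)
    then show ?thesis
      by (simp add: a_def b_def poly_sum poly_monom sum_distrib_left power_add mult_ac flip: power_mult)
  qed
  then show ?thesis
    using ca cb that[of a b] by simp
qed

definition D :: 'a where
  "D = fdet (2 * h) (\<lambda>i j. basis j (z i))"

text \<open>A kernel vector would hold the coefficients of a nonzero pair vanishing at all
  \<open>2 * h\<close> points, against \<open>generic_pair\<close>.\<close>

lemma D_nonzero: "D \<noteq> 0"
proof
  assume "D = 0"
  then obtain c j where c: "j < 2 * h" "c j \<noteq> 0" "\<And>i. i < 2 * h \<Longrightarrow> (\<Sum>j<2 * h. basis j (z i) * c j) = 0"
    unfolding D_def by (rule fdet_kernel) blast
  obtain a b where ab: "\<And>k. h \<le> k \<Longrightarrow> coeff a k = 0" "\<And>k. h \<le> k \<Longrightarrow> coeff b k = 0"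
    "\<And>x. (\<Sum>j<2 * h. basis j x * c j) = poly a (x ^ r) + x ^ p * poly b (x ^ r)"
    "\<And>k. k < h \<Longrightarrow> coeff a k = c (h + k)" "\<And>k. k < h \<Longrightarrow> coeff b k = c k"
    using basis_combination[of c] by blast
  have "a = 0" "b = 0"
    using generic_pair[of h a h b "{..<2 * h}"] ab c(3) by auto
  then show False
    using c(1,2) ab(4)[of "j - h"] ab(5)[of j] by (cases "j < h") (auto, linarith)
qed

lemma interpolation:
  obtains a b \<alpha> where "\<And>k. h \<le> k \<Longrightarrow> coeff a k = 0" "\<And>k. h \<le> k \<Longrightarrow> coeff b k = 0"
    "\<And>i. i < 2 * h \<Longrightarrow> poly a (z i ^ r) + z i ^ p * poly b (z i ^ r) = v i"
    "\<And>x. (\<Sum>j<2 * h. basis j x * \<alpha> j) = poly a (x ^ r) + x ^ p * poly b (x ^ r)"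
proof -
  obtain c where c: "\<And>i. i < 2 * h \<Longrightarrow> (\<Sum>j<2 * h. basis j (z i) * c j) = v i"
    using D_nonzero unfolding D_def by (rule fdet_solve[where v = v]) blast
  obtain a b where ab: "\<And>k. h \<le> k \<Longrightarrow> coeff a k = 0" "\<And>k. h \<le> k \<Longrightarrow> coeff b k = 0"
    "\<And>x. (\<Sum>j<2 * h. basis j x * c j) = poly a (x ^ r) + x ^ p * poly b (x ^ r)"
    by (rule basis_combination[of c]) blast
  have v: "poly a (z i ^ r) + z i ^ p * poly b (z i ^ r) = v i" if "i < 2 * h" for i
    using c[OF that] ab(3)[of "z i"] by simp
  show ?thesis
    by (rule that[of a b c]; (rule ab v)?) assumption+
qed

text \<open>Each generator is a top monomial corrected by an interpolant at the points
  \<open>z i\<close>. In the first pair only \<open>b1\<close> reaches degree \<open>h\<close>, in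
  the second only \<open>a2\<close>, and both are monic. The coefficients \<open>\<alpha>\<close>
  and \<open>\<beta>\<close> are kept because they are the column operations used for
  bordering.\<close>

lemma pencil:
  obtains a1 b1 a2 b2 \<alpha> \<beta> where
    "\<And>k. h \<le> k \<Longrightarrow> coeff a1 k = 0" "degree b1 = h" "lead_coeff b1 = 1"
    "degree a2 = h" "lead_coeff a2 = 1" "\<And>k. h \<le> k \<Longrightarrow> coeff b2 k = 0"
    "\<And>i. i < 2 * h \<Longrightarrow> poly a1 (z i ^ r) + z i ^ p * poly b1 (z i ^ r) = 0"
    "\<And>i. i < 2 * h \<Longrightarrow> poly a2 (z i ^ r) + z i ^ p * poly b2 (z i ^ r) = 0"
    "\<And>x. x ^ (h * r + p) + (\<Sum>j<2 * h. basis j x * \<alpha> j) = poly a1 (x ^ r) + x ^ p * poly b1 (x ^ r)"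
    "\<And>x. x ^ (h * r) + (\<Sum>j<2 * h. basis j x * \<beta> j) = poly a2 (x ^ r) + x ^ p * poly b2 (x ^ r)"
proof -
  have monic: "degree (monom 1 h + q) = h" "lead_coeff (monom 1 h + q) = 1"
    if "\<And>k. h \<le> k \<Longrightarrow> coeff q k = 0" for q :: "'a poly"
  proof -
    show "degree (monom 1 h + q) = h"
      by (rule antisym[OF degree_le le_degree]) (use that in auto)
    then show "lead_coeff (monom 1 h + q) = 1"
      using that by simp
  qed
  obtain a1 b1 \<alpha> where 1: "\<And>k. h \<le> k \<Longrightarrow> coeff a1 k = 0" "\<And>k. h \<le> k \<Longrightarrow> coeff b1 k = 0"
    "\<And>i. i < 2 * h \<Longrightarrow> poly a1 (z i ^ r) + z i ^ p * poly b1 (z i ^ r) = - (z i ^ p * (z i ^ r) ^ h)"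
    "\<And>x. (\<Sum>j<2 * h. basis j x * \<alpha> j) = poly a1 (x ^ r) + x ^ p * poly b1 (x ^ r)"
    by (rule interpolation[of "\<lambda>i. - (z i ^ p * (z i ^ r) ^ h)"]) blast
  obtain a2 b2 \<beta> where 2: "\<And>k. h \<le> k \<Longrightarrow> coeff a2 k = 0" "\<And>k. h \<le> k \<Longrightarrow> coeff b2 k = 0"
    "\<And>i. i < 2 * h \<Longrightarrow> poly a2 (z i ^ r) + z i ^ p * poly b2 (z i ^ r) = - ((z i ^ r) ^ h)"
    "\<And>x. (\<Sum>j<2 * h. basis j x * \<beta> j) = poly a2 (x ^ r) + x ^ p * poly b2 (x ^ r)"
    by (rule interpolation[of "\<lambda>i. - ((z i ^ r) ^ h)"]) blast
  have v1: "poly a1 (z i ^ r) + z i ^ p * poly (monom 1 h + b1) (z i ^ r) = 0" if "i < 2 * h" for i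
    using 1(3)[OF that] by (simp add: poly_monom distrib_left eq_neg_iff_add_eq_0 ac_simps)
  have v2: "poly (monom 1 h + a2) (z i ^ r) + z i ^ p * poly b2 (z i ^ r) = 0" if "i < 2 * h" for i
    using 2(3)[OF that] by (simp add: poly_monom eq_neg_iff_add_eq_0 ac_simps)
  have c1: "x ^ (h * r + p) + (\<Sum>j<2 * h. basis j x * \<alpha> j) =
      poly a1 (x ^ r) + x ^ p * poly (monom 1 h + b1) (x ^ r)" for x
    unfolding 1(4) by (simp add: poly_monom algebra_simps power_add flip: power_mult)
  have c2: "x ^ (h * r) + (\<Sum>j<2 * h. basis j x * \<beta> j) =
      poly (monom 1 h + a2) (x ^ r) + x ^ p * poly b2 (x ^ r)" for x
    unfolding 2(4) by (simp add: poly_monom algebra_simps flip: power_mult)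
  show ?thesis
    by (rule that[OF 1(1) monic(1)[OF 1(2)] monic(2)[OF 1(2)] monic(1)[OF 2(1)] monic(2)[OF 2(1)]
          2(2) v1 v2 c1 c2])
qed

section \<open>The resultant of the pencil\<close>

text \<open>The unknown quantities are \<open>T\<close> and \<open>E\<close>, products of values of
  \<open>b1\<close>, and \<open>A\<close>, the resultant of \<open>b1\<close> and \<open>a1\<close>.
  \<open>S1\<close> and \<open>S3\<close> eliminate \<open>A\<close>; \<open>S4\<close>,
  \<open>S5\<close> and \<open>S6\<close> express \<open>E * R\<close> through \<open>T\<close> and
  explicit factors; the remaining powers of \<open>T\<close> cancel by \<open>S2\<close>.\<close>

lemma resultant_formula:
  fixes a1 b1 a2 b2 F G :: "'a poly" and \<phi> :: "nat \<Rightarrow> 'a" and N :: nat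
  defines "P \<equiv> newton z (2 * h)"
  defines "R \<equiv> \<Prod>k<N. poly G (\<phi> k)" and "V \<equiv> vdm (2 * h) (\<lambda>i. z i ^ r)"
  assumes a1: "\<And>k. h \<le> k \<Longrightarrow> coeff a1 k = 0" and b1: "degree b1 = h" "lead_coeff b1 = 1"
    and a2: "degree a2 = h" "lead_coeff a2 = 1" and b2: "\<And>k. h \<le> k \<Longrightarrow> coeff b2 k = 0"
    and f: "\<And>x. poly a1 (x ^ r) + x ^ p * poly b1 (x ^ r) = poly P x * poly F x"
    and g: "\<And>x. poly a2 (x ^ r) + x ^ p * poly b2 (x ^ r) = poly P x * poly G x"
    and F: "F = newton \<phi> N"
  shows "R * D ^ r * V\<^sup>2 * (-1) ^ ((N + 1) * r * h) =
    of_bool (h = 0 \<or> coprime p r) * (\<Prod>i<2 * h. z i) ^ ((p - 1) * (r - 1)) * V ^ r *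
    (vdm (2 * h) z)\<^sup>2"
proof -
  define t where "t i = z i ^ r" for i
  define U :: "'a set" where "U = unity_roots r - {1}"
  define T where "T = (\<Prod>i<2 * h. poly b1 (t i))"
  define E where "E = (\<Prod>k<N. poly b1 (\<phi> k ^ r))"
  define Z where "Z = (\<Prod>i<2 * h. z i)"
  define C1 Cp where "C1 = (\<Prod>\<zeta>\<in>U. \<zeta> - 1)" and "Cp = (\<Prod>\<zeta>\<in>U. \<zeta> ^ p - 1)"
  define QF where "QF = (\<Prod>i<2 * h. \<Prod>\<zeta>\<in>U. poly F (\<zeta> * z i))"
  define PP where "PP = (\<Prod>i<2 * h. \<Prod>\<zeta>\<in>U. poly P (\<zeta> * z i))"
  have P0: "poly P (z i) = 0" if "i < 2 * h" for i
    using that by (auto simp: P_def poly_newton)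
  have f0: "poly a1 (t i) = - (z i ^ p * poly b1 (t i))" if "i < 2 * h" for i
    using f[of "z i"] P0[OF that] by (simp add: t_def add_eq_0_iff2)
  have g0: "poly a2 (t i) = - (z i ^ p * poly b2 (t i))" if "i < 2 * h" for i
    using g[of "z i"] P0[OF that] by (simp add: t_def add_eq_0_iff2)
  have finU: "finite U" and cardU: "card U = r - 1"
    unfolding U_def using r_pos by (simp_all add: prod_unity_roots_one)
  obtain \<beta> where \<beta>: "b1 = newton \<beta> h"
    using alg_closed_newton[of b1] b1 by metis
  define A where "A = (\<Prod>m<h. poly a1 (\<beta> m))"

  \<comment> \<open>A Sylvester determinant of \<open>a1\<close> and \<open>b1\<close> at the points
    \<open>t i\<close>. There \<open>a1\<close> equals \<open>- z i ^ p\<close> times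
    \<open>b1\<close>, so row \<open>i\<close> has the common factor \<open>poly b1 (t i)\<close>,
    and what is left is \<open>D\<close> with its first \<open>h\<close> columns negated.\<close>
  have S1: "T * ((-1) ^ h * D) = V * A"
  proof -
    have "V * A = fdet (2 * h) (\<lambda>i j. if j < h then poly a1 (t i) * t i ^ j
                         else poly (newton \<beta> h) (t i) * t i ^ (j - h))"
      unfolding V_def A_def
      by (subst fdet_sylvester) (auto simp: t_def[abs_def] intro!: degree_le a1)
    also have "\<dots> = fdet (2 * h) (\<lambda>i j. poly b1 (t i) * ((if j < h then -1 else 1) * basis j (z i)))"
      by (rule fdet_cong)
         (auto simp: basis_def t_def f0[unfolded t_def] \<beta>[symmetric] power_add mult_ac simp flip: power_mult)
    also have "\<dots> = T * ((\<Prod>j<2 * h. if j < h then -1 else 1) * D)"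
      unfolding fdet_mult_row fdet_mult_col T_def D_def ..
    also have "(\<Prod>j<2 * h. if j < h then -1 else 1 :: 'a) = (\<Prod>j<h. -1)"
      by (rule prod.mono_neutral_cong_right) auto
    finally show ?thesis by simp
  qed

  \<comment> \<open>A zero of \<open>b1\<close> at \<open>t i\<close> is also a zero of
    \<open>a1\<close>. Dividing both by the linear factor leaves a pair with
    \<open>2 * h - 1\<close> coefficients vanishing at the \<open>2 * h - 1\<close> other points,
    which genericity forbids.\<close>
  have S2: "T \<noteq> 0"
  proof
    assume "T = 0"
    then obtain i where i: "i < 2 * h" "poly b1 (t i) = 0"
      by (auto simp: T_def)
    then have "poly a1 (t i) = 0"
      using f0 by simp
    then obtain a' where a': "a1 = [:- t i, 1:] * a'"
      by (auto simp: poly_eq_0_iff_dvd)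
    obtain b' where b': "b1 = [:- t i, 1:] * b'"
      using i(2) by (auto simp: poly_eq_0_iff_dvd)
    have "b' \<noteq> 0"
      using b1(2) b' by auto
    then have degb': "degree b' < h"
      using b1(1) unfolding b' by (subst (asm) degree_mult_eq) auto
    have dega': "coeff a' k = 0" if "h - 1 \<le> k" for k
    proof (cases "a' = 0")
      case False
      have "degree a1 = Suc (degree a')"
        unfolding a' using False by (subst degree_mult_eq) auto
      moreover have "a1 \<noteq> 0"
        using False unfolding a' mult_eq_0_iff by simp
      ultimately have "Suc (degree a') < h"
        using a1[of "degree a1"] by (metis leading_coeff_0_iff linorder_not_le)
      then show ?thesis using that by (intro coeff_eq_0) auto
    qed simp
    have "b' = 0"
    proof (rule generic_pair(2)[of "h - 1" a' h b' "{..<2 * h} - {i}"])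
      fix j assume j: "j \<in> {..<2 * h} - {i}"
      then have "t j - t i \<noteq> 0"
        using i(1) inj_powers by (auto simp: t_def inj_on_def)
      moreover have "(t j - t i) * (poly a' (t j) + z j ^ p * poly b' (t j)) = 0"
        using f0[of j] j unfolding a' b' by (simp add: algebra_simps)
      ultimately show "poly a' (z j ^ r) + z j ^ p * poly b' (z j ^ r) = 0"
        by (simp add: t_def)
    qed (use i(1) dega' degb' in \<open>auto simp: coeff_eq_0\<close>)
    with \<open>b' \<noteq> 0\<close> show False ..
  qed

  \<comment> \<open>Both products are regrouped by the roots \<open>\<beta> m\<close> of
    \<open>b1\<close>. At each \<open>r\<close>-th root \<open>\<eta> l\<close> of
    \<open>\<beta> m\<close> the term with \<open>b1\<close> drops out of the first generator, so
    \<open>P * F\<close> takes the value \<open>poly a1 (\<beta> m)\<close>.\<close>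
  have S3: "E * T = (-1) ^ (N * r * h) * A ^ r"
  proof -
    have *: "(\<Prod>k<N. \<phi> k ^ r - \<beta> m) * (\<Prod>i<2 * h. t i - \<beta> m) = (-1) ^ (N * r) * poly a1 (\<beta> m) ^ r"
      if m: "m < h" for m
    proof -
      obtain \<eta> where \<eta>: "newton \<eta> r = monom 1 r - [:\<beta> m:]"
        using newton_eq_monom[OF r_pos] by metis
      have split: "x ^ r - \<beta> m = (\<Prod>l<r. x - \<eta> l)" for x
        using arg_cong[OF \<eta>, of "\<lambda>q. poly q x"] by (simp add: poly_newton poly_monom)
      have \<eta>r: "\<eta> l ^ r = \<beta> m" if "l < r" for l
      proof -
        have "(\<Prod>k<r. \<eta> l - \<eta> k) = 0"
          using that by auto
        then show ?thesis
          unfolding split[of "\<eta> l", symmetric] by simp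
      qed
      have "poly b1 (\<beta> m) = 0"
        unfolding \<beta> using m by (auto simp: poly_newton)
      then have PF: "poly P (\<eta> l) * poly F (\<eta> l) = poly a1 (\<beta> m)" if "l < r" for l
        using f[of "\<eta> l"] by (simp add: \<eta>r[OF that])
      have "(\<Prod>k<N. \<phi> k ^ r - \<beta> m) = (\<Prod>l<r. \<Prod>k<N. \<phi> k - \<eta> l)"
        unfolding split by (rule prod.swap)
      also have "\<dots> = (\<Prod>l<r. (-1) ^ N * poly F (\<eta> l))"
        unfolding prod_diff_swap F poly_newton ..
      finally have 1: "(\<Prod>k<N. \<phi> k ^ r - \<beta> m) = (\<Prod>l<r. (-1) ^ N * poly F (\<eta> l))" .
      have "(\<Prod>i<2 * h. t i - \<beta> m) = (\<Prod>l<r. \<Prod>i<2 * h. z i - \<eta> l)"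
        unfolding split t_def by (rule prod.swap)
      also have "\<dots> = (\<Prod>l<r. poly P (\<eta> l))"
        unfolding prod_diff_swap P_def poly_newton by simp
      finally have "(\<Prod>k<N. \<phi> k ^ r - \<beta> m) * (\<Prod>i<2 * h. t i - \<beta> m) =
          (\<Prod>l<r. (-1) ^ N * (poly P (\<eta> l) * poly F (\<eta> l)))"
        unfolding 1 by (simp add: prod.distrib mult_ac)
      also have "\<dots> = (\<Prod>l<r. (-1) ^ N * poly a1 (\<beta> m))"
        by (rule prod.cong) (auto simp: PF)
      finally show ?thesis
        by (simp add: power_mult_distrib flip: power_mult)
    qed
    have "E = (\<Prod>m<h. \<Prod>k<N. \<phi> k ^ r - \<beta> m)" "T = (\<Prod>m<h. \<Prod>i<2 * h. t i - \<beta> m)"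
      unfolding E_def T_def \<beta> poly_newton by (rule prod.swap)+
    then have "E * T = (\<Prod>m<h. (-1) ^ (N * r) * poly a1 (\<beta> m) ^ r)"
      by (simp add: * flip: prod.distrib)
    then show ?thesis
      by (simp add: prod.distrib A_def prod_power_distrib flip: power_mult)
  qed

  \<comment> \<open>Eliminating between the two generators gives
    \<open>W = a2 * b1 - a1 * b2\<close>, monic of degree \<open>2 * h\<close> with zeros
    \<open>t i\<close>. Hence \<open>W\<close> at \<open>x ^ r\<close> is \<open>P * Q\<close>, and
    cancelling \<open>P\<close> leaves an identity whose term with \<open>F\<close> vanishes at the
    roots \<open>\<phi> k\<close>.\<close>
  have S4: "E * R = QF"
  proof -
    define W where "W = a2 * b1 - a1 * b2"
    define Q where "Q = (\<Prod>i<2 * h. \<Prod>\<zeta>\<in>U. [:- (\<zeta> * z i), 1:])"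
    let ?M = "monom (1 :: 'a) r"
    have W: "W = newton t (2 * h)"
    proof (rule monic_eq_newton)
      show "inj_on t {..<2 * h}"
        using inj_powers by (simp add: t_def[abs_def])
      show "poly W (t i) = 0" if "i < 2 * h" for i
        by (simp add: W_def f0 g0 that)
      have b1nz: "b1 \<noteq> 0" and a2nz: "a2 \<noteq> 0"
        using b1(2) a2(2) by auto
      have zero: "coeff (a1 * b2) k = 0" if "2 * h \<le> k" for k
      proof -
        have "coeff a1 i * coeff b2 (k - i) = 0" if "i \<le> k" for i
          using a1[of i] b2[of "k - i"] \<open>2 * h \<le> k\<close> that by (cases "h \<le> i") auto
        then show ?thesis
          unfolding coeff_mult by (intro sum.neutral ballI) simp
      qed
      have d: "degree (a2 * b1) = 2 * h"
        using a2(1) b1(1) b1nz a2nz by (simp add: degree_mult_eq)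
      have l: "coeff (a2 * b1) (2 * h) = 1"
        using lead_coeff_mult[of a2 b1] a2(2) b1(2) by (simp add: d)
      show dW: "degree W = 2 * h"
      proof (rule antisym)
        show "degree W \<le> 2 * h"
          by (rule degree_le) (auto simp: W_def zero coeff_eq_0 d)
        show "2 * h \<le> degree W"
          by (rule le_degree) (simp add: W_def zero l)
      qed
      show "lead_coeff W = 1"
        unfolding dW by (simp add: W_def zero l)
    qed
    have PQ: "poly P x * poly Q x = poly W (x ^ r)" for x
    proof -
      have "poly W (x ^ r) = (\<Prod>i<2 * h. \<Prod>\<zeta>\<in>unity_roots r. x - \<zeta> * z i)"
        unfolding W poly_newton t_def using r_pos by (simp add: prod_unity_roots)
      also have "\<dots> = (\<Prod>i<2 * h. (x - z i) * (\<Prod>\<zeta>\<in>U. x - \<zeta> * z i))"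
        unfolding U_def using r_pos by (simp add: prod.remove[of _ 1] prod_unity_roots_one)
      finally show ?thesis
        by (simp add: prod.distrib P_def poly_newton Q_def poly_prod)
    qed
    \<comment> \<open>Verified pointwise, which suffices over an infinite field.\<close>
    have "P * (pcompose b1 ?M * G - pcompose b2 ?M * F) = P * Q"
    proof (rule poly_eq_poly_eq_iff[THEN iffD1], rule ext)
      fix x
      have "poly (P * (pcompose b1 ?M * G - pcompose b2 ?M * F)) x =
          poly b1 (x ^ r) * (poly P x * poly G x) - poly b2 (x ^ r) * (poly P x * poly F x)"
        by (simp add: poly_pcompose poly_monom algebra_simps)
      also have "\<dots> = poly W (x ^ r)"
        unfolding f[symmetric] g[symmetric] by (simp add: W_def algebra_simps)
      finally show "poly (P * (pcompose b1 ?M * G - pcompose b2 ?M * F)) x = poly (P * Q) x"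
        by (simp add: PQ)
    qed
    then have Q: "pcompose b1 ?M * G - pcompose b2 ?M * F = Q"
      by (simp add: P_def)
    have "poly b1 (\<phi> k ^ r) * poly G (\<phi> k) = poly Q (\<phi> k)" if "k < N" for k
    proof -
      have "poly F (\<phi> k) = 0"
        using that by (auto simp: F poly_newton)
      then show ?thesis
        by (simp add: poly_pcompose poly_monom flip: Q)
    qed
    then have "E * R = (\<Prod>k<N. \<Prod>i<2 * h. \<Prod>\<zeta>\<in>U. \<phi> k - \<zeta> * z i)"
      by (simp add: E_def R_def Q_def poly_prod flip: prod.distrib)
    also have "\<dots> = (\<Prod>i<2 * h. \<Prod>\<zeta>\<in>U. \<Prod>k<N. \<phi> k - \<zeta> * z i)"
      by (subst prod.swap) (intro prod.cong refl prod.swap)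
    also have "\<dots> = (\<Prod>i<2 * h. \<Prod>\<zeta>\<in>U. (-1) ^ N * poly F (\<zeta> * z i))"
      unfolding prod_diff_swap F poly_newton ..
    \<comment> \<open>The sign \<open>(-1) ^ N\<close> occurs for each of \<open>2 * h\<close>
      indices \<open>i\<close>, hence an even number of times for each
      \<open>\<zeta>\<close>.\<close>
    also have "\<dots> = QF"
      by (simp add: prod.distrib QF_def power_mult flip: power_mult)
    finally show ?thesis .
  qed

  \<comment> \<open>The points \<open>\<zeta> * z i\<close> and \<open>z i\<close> have the same
    \<open>r\<close>-th power, so only the factor \<open>x ^ p\<close> of the generator
    distinguishes them.\<close>
  have S5: "QF * PP = Cp ^ (2 * h) * Z ^ (p * (r - 1)) * T ^ (r - 1)"
  proof -
    have *: "poly F (\<zeta> * z i) * poly P (\<zeta> * z i) = (\<zeta> ^ p - 1) * (z i ^ p * poly b1 (t i))"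
      if "i < 2 * h" "\<zeta> \<in> U" for i \<zeta>
    proof -
      have "(\<zeta> * z i) ^ r = t i"
        using that(2) by (simp add: U_def unity_roots_def t_def power_mult_distrib)
      then show ?thesis
        using f[of "\<zeta> * z i"] f0[OF that(1)] by (simp add: power_mult_distrib algebra_simps)
    qed
    have "QF * PP = (\<Prod>i<2 * h. \<Prod>\<zeta>\<in>U. (\<zeta> ^ p - 1) * (z i ^ p * poly b1 (t i)))"
      unfolding QF_def PP_def prod.distrib[symmetric] by (intro prod.cong refl) (simp add: *)
    then show ?thesis
      by (simp add: prod.distrib Cp_def Z_def T_def cardU prod_power_distrib power_mult_distrib
          flip: power_mult)
  qed

  \<comment> \<open>The diagonal factors of the double product give powers of \<open>z i\<close> and
    \<open>C1\<close>; each pair of distinct indices gives the square of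
    \<open>(t j - t i) / (z j - z i)\<close>, and the Vandermonde square clears these
    denominators.\<close>
  have S6: "PP * (vdm (2 * h) z)\<^sup>2 = Z ^ (r - 1) * C1 ^ (2 * h) * V\<^sup>2"
  proof -
    define c where "c i j = (\<Prod>\<zeta>\<in>U. \<zeta> * z i - z j)" for i j
    have "PP = (\<Prod>i<2 * h. \<Prod>j<2 * h. c i j)"
      unfolding PP_def P_def poly_newton c_def by (intro prod.cong refl prod.swap)
    also have "\<dots> = (\<Prod>i<2 * h. c i i) * (\<Prod>j<2 * h. \<Prod>i<j. c i j * c j i)"
      unfolding prod_offdiagonal[symmetric] prod.distrib[symmetric]
      by (rule prod.cong) (simp_all add: prod.remove)
    also have "(\<Prod>i<2 * h. c i i) = Z ^ (r - 1) * C1 ^ (2 * h)"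
    proof -
      have "c i i = C1 * z i ^ (r - 1)" for i
      proof -
        have "c i i = (\<Prod>\<zeta>\<in>U. (\<zeta> - 1) * z i)"
          by (simp add: c_def algebra_simps)
        then show ?thesis
          by (simp add: prod.distrib C1_def cardU)
      qed
      then show ?thesis
        by (simp add: prod.distrib Z_def prod_power_distrib)
    qed
    finally have PP: "PP = Z ^ (r - 1) * C1 ^ (2 * h) * (\<Prod>j<2 * h. \<Prod>i<j. c i j * c j i)" .
    have "(\<Prod>j<2 * h. \<Prod>i<j. c i j * c j i) * (vdm (2 * h) z)\<^sup>2 = V\<^sup>2"
    proof -
      have c: "c i j = (-1) ^ (r - 1) * ((t j - t i) / (z j - z i))" if "z i \<noteq> z j" for i j
      proof -
        have "c i j = (\<Prod>\<zeta>\<in>U. (-1) * (z j - \<zeta> * z i))"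
          by (simp add: c_def)
        also have "\<dots> = (-1) ^ (r - 1) * (\<Prod>\<zeta>\<in>U. z j - \<zeta> * z i)"
          unfolding prod.distrib by (simp add: cardU)
        finally show ?thesis
          using that r_pos by (simp add: U_def prod_nontrivial_unity_roots t_def)
      qed
      have "c i j * c j i * (z j - z i)\<^sup>2 = (t j - t i)\<^sup>2" if "i < j" "j < 2 * h" for i j
      proof -
        have ne: "z i \<noteq> z j"
          using inj_on_eq_iff[OF inj_z, of i j] that by auto
        have "(t i - t j) / (z i - z j) = (t j - t i) / (z j - z i)"
          using minus_divide_divide[of "t j - t i" "z j - z i"] by simp
        then have "c i j * c j i = ((-1) ^ (r - 1) * (-1) ^ (r - 1)) * ((t j - t i) / (z j - z i))\<^sup>2"
          using ne by (simp add: c power2_eq_square)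
        then show ?thesis
          using ne by (simp add: power_divide flip: power_add mult_2)
      qed
      then show ?thesis
        unfolding vdm_def V_def prod_power_distrib prod.distrib[symmetric]
        by (intro prod.cong refl) (auto simp: t_def)
    qed
    then show ?thesis
      by (simp add: PP mult.assoc)
  qed

  have V0: "V \<noteq> 0"
    unfolding V_def by (rule vdm_nonzero[OF inj_powers])
  have v0: "vdm (2 * h) z \<noteq> 0"
    by (rule vdm_nonzero[OF inj_z])
  have Z0: "Z \<noteq> 0"
    using z_nonzero by (auto simp: Z_def)
  have C10: "C1 \<noteq> 0"
    using finU by (auto simp: C1_def U_def)
  \<comment> \<open>The coprimality condition enters here. For \<open>h = 0\<close> the exponent is
    zero and both sides are 1.\<close>
  have Cp: "Cp ^ (2 * h) = of_bool (h = 0 \<or> coprime p r) * C1 ^ (2 * h)"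
    using prod_unity_roots_power_minus_one[OF r_pos p_pos, where 'a = 'a]
    by (simp add: Cp_def C1_def U_def)
  have r: "T ^ r = T * T ^ (r - 1)"
    using r_pos by (metis power_minus_mult mult.commute)
  have pr: "Z ^ (p * (r - 1)) = Z ^ (r - 1) * Z ^ ((p - 1) * (r - 1))"
    using p_pos by (cases p) (simp_all add: power_add)
  \<comment> \<open>Combines the \<open>r\<close>-th power of \<open>S1\<close> with
    \<open>S3\<close> to eliminate \<open>A\<close>; one factor \<open>T\<close> is then
    cancelled.\<close>
  have "T * ((-1) ^ (N * r * h) * ((-1) ^ h * D) ^ r * T ^ (r - 1)) = T * (E * V ^ r)"
  proof -
    have "T * ((-1) ^ (N * r * h) * ((-1) ^ h * D) ^ r * T ^ (r - 1)) =
        (-1) ^ (N * r * h) * (T * ((-1) ^ h * D)) ^ r"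
      unfolding power_mult_distrib[of T] r by (simp only: mult_ac)
    also have "\<dots> = T * (E * V ^ r)"
      unfolding S1 power_mult_distrib[of V]
      using arg_cong[OF S3, of "\<lambda>x. x * V ^ r"] by (simp only: mult_ac)
    finally show ?thesis .
  qed
  then have EV: "E * V ^ r = (-1) ^ ((N + 1) * r * h) * D ^ r * T ^ (r - 1)"
    using S2 by (simp add: power_mult_distrib power_add algebra_simps flip: power_mult)
  \<comment> \<open>The claim multiplied by a nonzero factor, so that \<open>S4\<close>,
    \<open>S5\<close> and \<open>S6\<close> can be substituted without division.\<close>
  have "(T ^ (r - 1) * Z ^ (r - 1) * C1 ^ (2 * h)) * (R * D ^ r * V\<^sup>2 * (-1) ^ ((N + 1) * r * h)) =
      (R * V\<^sup>2 * Z ^ (r - 1) * C1 ^ (2 * h)) * ((-1) ^ ((N + 1) * r * h) * D ^ r * T ^ (r - 1))"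
    by (simp only: mult_ac)
  also have "\<dots> = (E * R) * (Z ^ (r - 1) * C1 ^ (2 * h) * V\<^sup>2) * V ^ r"
    unfolding EV[symmetric] by (simp only: mult_ac)
  also have "\<dots> = (QF * PP) * (V ^ r * (vdm (2 * h) z)\<^sup>2)"
    unfolding S4 S6[symmetric] by (simp only: mult_ac)
  also have "\<dots> = (T ^ (r - 1) * Z ^ (r - 1) * C1 ^ (2 * h)) *
      (of_bool (h = 0 \<or> coprime p r) * Z ^ ((p - 1) * (r - 1)) * V ^ r * (vdm (2 * h) z)\<^sup>2)"
    unfolding S5 Cp pr by (simp only: mult_ac)
  finally show ?thesis
    using S2 Z0 C10 by (simp add: Z_def)
qed

section \<open>The determinant over an algebraically closed field\<close>

lemma columns_nth:
  assumes "j < 2 * h"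
  shows "((map (\<lambda>k i. w i ^ (k * r + p)) [0..<h] @ map (\<lambda>k i. w i ^ (k * r)) [0..<h]) ! j) i = basis j (w i)"
  using assms by (auto simp: nth_append basis_def)

lemma alternant_eq_D: "alternant r p h z = (-1) ^ (h choose 2) * D"
proof -
  have "alternant r p h z = (-1) ^ (h choose 2) *
      cdet (map (\<lambda>k i. z i ^ (k * r + p)) [0..<h] @ map (\<lambda>k i. z i ^ (k * r)) [0..<h])"
    using cdet_interleave[of "[]"] by (simp add: alternant_def)
  also have "cdet (map (\<lambda>k i. z i ^ (k * r + p)) [0..<h] @ map (\<lambda>k i. z i ^ (k * r)) [0..<h]) = D"
    unfolding cdet_def D_def by (simp add: mult_2[symmetric], rule fdet_cong) (rule columns_nth)
  finally show ?thesis .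
qed

lemma alternant_border:
  assumes w: "\<And>i. i < 2 * h \<Longrightarrow> w i = z i"
    and f: "\<And>x. f x = x ^ (h * r + p) + (\<Sum>j<2 * h. basis j x * \<alpha> j)"
    and g: "\<And>x. g x = x ^ (h * r) + (\<Sum>j<2 * h. basis j x * \<beta> j)"
    and zero: "\<And>i. i < 2 * h \<Longrightarrow> f (z i) = 0" "\<And>i. i < 2 * h \<Longrightarrow> g (z i) = 0"
  shows "alternant r p (Suc h) w = alternant r p h z *
    (f (w (2 * h)) * g (w (Suc (2 * h))) - g (w (2 * h)) * f (w (Suc (2 * h))))"
proof -
  define bs where "bs = map (\<lambda>k i. w i ^ (k * r + p)) [0..<h] @ map (\<lambda>k i. w i ^ (k * r)) [0..<h]"
  define u v where "u = (\<lambda>i. w i ^ (h * r + p))" and "v = (\<lambda>i. w i ^ (h * r))"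
  have len: "length bs = 2 * h"
    by (simp add: bs_def)
  have "alternant r p (Suc h) w = (-1) ^ (h choose 2) * cdet ([u, v] @ bs)"
    using cdet_interleave[of "[u, v]"] by (simp add: alternant_def bs_def u_def v_def)
  also have "cdet ([u, v] @ bs) = cdet (u # (v # bs) @ [])"
    by simp
  \<comment> \<open>The column \<open>u\<close> crosses \<open>v\<close> and the
    \<open>2 * h\<close> columns of \<open>bs\<close>, an odd number; the later exchange of
    \<open>v\<close> and \<open>u\<close> restores the sign.\<close>
  also have "\<dots> = - cdet (v # bs @ [u])"
    using cdet_move[of "[]" u "v # bs" "[]"] by (simp add: len)
  also have "cdet (v # bs @ [u]) = cdet (bs @ v # [u])"
    using cdet_move[of "[]" v bs "[u]"] by (simp add: len)
  also have "- cdet (bs @ v # [u]) = cdet (bs @ u # [v])"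
    by (subst cdet_swap) simp
  also have "cdet (bs @ u # [v]) = fdet (2 * h + 2) (\<lambda>i j. ((bs @ [u, v]) ! j) i)"
    by (simp add: cdet_def len)
  also have "\<dots> = fdet (2 * h) (\<lambda>i j. ((bs @ [u, v]) ! j) i) *
      (f (w (2 * h)) * g (w (Suc (2 * h))) - g (w (2 * h)) * f (w (Suc (2 * h))))"
  proof (rule fdet_border[where \<alpha> = \<alpha> and \<beta> = \<beta>])
    have b: "(bs ! j) i = basis j (w i)" if "j < 2 * h" for i j
      using that by (auto simp: nth_append bs_def basis_def)
    show "f (w i) = ((bs @ [u, v]) ! (2 * h)) i + (\<Sum>j<2 * h. ((bs @ [u, v]) ! j) i * \<alpha> j)" for i
      by (simp add: f b nth_append len u_def)
    show "g (w i) = ((bs @ [u, v]) ! Suc (2 * h)) i + (\<Sum>j<2 * h. ((bs @ [u, v]) ! j) i * \<beta> j)" for i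
      by (simp add: g b nth_append len v_def)
  qed (simp_all add: w zero)
  also have "fdet (2 * h) (\<lambda>i j. ((bs @ [u, v]) ! j) i) = D"
    unfolding D_def
    by (rule fdet_cong) (auto simp: nth_append bs_def basis_def w)
  finally show ?thesis
    by (simp add: alternant_eq_D)
qed

text \<open>Bordering puts the values of \<open>newton z (2 * h)\<close> at \<open>x\<close> and
  \<open>y\<close> into the numerator, and the larger Vandermonde product puts the same two values
  into the denominator. Raising \<open>h\<close> by one flips the sign in \<open>schur2\<close>,
  which turns \<open>y - x\<close> into \<open>x - y\<close>.\<close>

lemma schur2_border:
  assumes w: "\<And>i. i < 2 * h \<Longrightarrow> w i = z i" and xy: "w (2 * h) = x" "w (Suc (2 * h)) = y"
    and f: "\<And>x. poly (newton z (2 * h)) x * poly F x = x ^ (h * r + p) + (\<Sum>j<2 * h. basis j x * \<alpha> j)"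
    and g: "\<And>x. poly (newton z (2 * h)) x * poly G x = x ^ (h * r) + (\<Sum>j<2 * h. basis j x * \<beta> j)"
    and ne: "\<And>i. i < 2 * h \<Longrightarrow> x \<noteq> z i" "\<And>i. i < 2 * h \<Longrightarrow> y \<noteq> z i" "x \<noteq> y"
  shows "schur2 r p (Suc h) w =
    schur2 r p h z * ((poly F x * poly G y - poly F y * poly G x) / (x - y))"
proof -
  define P where "P = newton z (2 * h)"
  have P0: "poly P (z i) = 0" if "i < 2 * h" for i
    using that by (auto simp: P_def poly_newton)
  have Pxy: "poly P x \<noteq> 0" "poly P y \<noteq> 0"
    using ne by (auto simp: P_def poly_newton)
  have "alternant r p (Suc h) w = alternant r p h z *
    ((poly P x * poly F x) * (poly P y * poly G y) - (poly P x * poly G x) * (poly P y * poly F y))"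
    unfolding xy[symmetric]
  proof (rule alternant_border[where f = "\<lambda>x. poly P x * poly F x" and g = "\<lambda>x. poly P x * poly G x"])
    show "poly P x * poly F x = x ^ (h * r + p) + (\<Sum>j<2 * h. basis j x * \<alpha> j)" for x
      using f by (simp add: P_def)
    show "poly P x * poly G x = x ^ (h * r) + (\<Sum>j<2 * h. basis j x * \<beta> j)" for x
      using g by (simp add: P_def)
  qed (simp_all add: w P0)
  then have 1: "alternant r p (Suc h) w = alternant r p h z * (poly P x * poly P y) *
      (poly F x * poly G y - poly F y * poly G x)"
    by (simp add: algebra_simps)
  have "vdm (2 * Suc h) w = vdm (2 * h) w * (\<Prod>i<2 * h. w (2 * h) - w i) *
      ((\<Prod>i<2 * h. w (Suc (2 * h)) - w i) * (w (Suc (2 * h)) - w (2 * h)))"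
    by (simp add: vdm_def)
  also have "vdm (2 * h) w = vdm (2 * h) z"
    unfolding vdm_def by (intro prod.cong refl) (simp add: w)
  finally have "vdm (2 * Suc h) w = vdm (2 * h) z * poly P x * (poly P y * (y - x))"
    by (simp add: xy P_def poly_newton w)
  then have 2: "vdm (2 * Suc h) w = - (vdm (2 * h) z * (poly P x * poly P y) * (x - y))"
    by (simp add: algebra_simps)
  show ?thesis
  proof -
    let ?q = "poly P x * poly P y" and ?B = "poly F x * poly G y - poly F y * poly G x"
    have "schur2 r p (Suc h) w =
        (?q * (alternant r p h z * ?B)) / (?q * (((-1) ^ h * vdm (2 * h) z) * (x - y)))"
      unfolding schur2_def 1 2 by (rule arg_cong2[of _ _ _ _ "(/)"]) (simp_all add: mult_ac)
    also have "\<dots> = (alternant r p h z * ?B) / (((-1) ^ h * vdm (2 * h) z) * (x - y))"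
      by (rule mult_divide_mult_cancel_left) (use Pxy in simp)
    finally show ?thesis
      by (simp add: schur2_def)
  qed
qed

text \<open>Combines the Bezoutian determinant with the resultant. Writing
  \<open>s = schur2 r p h z\<close>, the rows contribute \<open>s ^ N\<close> and the factor
  \<open>D ^ r\<close> of the resultant formula contributes \<open>s ^ r\<close> in the denominator;
  the exponent \<open>N - r\<close> may be negative, hence the integer power.\<close>

theorem det_schur2:
  fixes x y :: "nat \<Rightarrow> 'a" and N :: nat
  defines "w \<equiv> \<lambda>i j k. if k < 2 * h then z k else if k = 2 * h then x i else y j"
  assumes N: "N = h * (r - 2) + p"
    and x: "\<And>i k. i < N \<Longrightarrow> k < 2 * h \<Longrightarrow> x i \<noteq> z k"
    and y: "\<And>j k. j < N \<Longrightarrow> k < 2 * h \<Longrightarrow> y j \<noteq> z k"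
    and xy: "\<And>i j. i < N \<Longrightarrow> j < N \<Longrightarrow> x i \<noteq> y j"
  shows "fdet N (\<lambda>i j. schur2 r p (Suc h) (w i j)) =
    (-1) ^ ((N choose 2) + N * r * h + r * (h choose 2)) * of_bool (h = 0 \<or> coprime p r) *
    vdm N x * vdm N y * (\<Prod>i<2 * h. z i) ^ ((p - 1) * (r - 1)) *
    (vdm (2 * h) (\<lambda>i. z i ^ r) / vdm (2 * h) z) ^ (r - 2) *
    schur2 r p h z powi (int N - int r)"
proof -
  let ?M = "monom (1 :: 'a) r"
  define P where "P = newton z (2 * h)"
  obtain a1 b1 a2 b2 \<alpha> \<beta> where a1: "\<And>k. h \<le> k \<Longrightarrow> coeff a1 k = 0" and b1: "degree b1 = h" "lead_coeff b1 = 1"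
    and a2: "degree a2 = h" "lead_coeff a2 = 1" and b2: "\<And>k. h \<le> k \<Longrightarrow> coeff b2 k = 0"
    and f0: "\<And>i. i < 2 * h \<Longrightarrow> poly a1 (z i ^ r) + z i ^ p * poly b1 (z i ^ r) = 0"
    and g0: "\<And>i. i < 2 * h \<Longrightarrow> poly a2 (z i ^ r) + z i ^ p * poly b2 (z i ^ r) = 0"
    and f: "\<And>x. x ^ (h * r + p) + (\<Sum>j<2 * h. basis j x * \<alpha> j) = poly a1 (x ^ r) + x ^ p * poly b1 (x ^ r)"
    and g: "\<And>x. x ^ (h * r) + (\<Sum>j<2 * h. basis j x * \<beta> j) = poly a2 (x ^ r) + x ^ p * poly b2 (x ^ r)"
    by (rule pencil) blast
  define fp where "fp = pcompose a1 ?M + monom 1 p * pcompose b1 ?M"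
  define gp where "gp = pcompose a2 ?M + monom 1 p * pcompose b2 ?M"
  have fp: "poly fp x = poly a1 (x ^ r) + x ^ p * poly b1 (x ^ r)"
    and gp: "poly gp x = poly a2 (x ^ r) + x ^ p * poly b2 (x ^ r)" for x
    by (simp_all add: fp_def gp_def poly_pcompose poly_monom)
  obtain F where F: "fp = P * F"
    using newton_dvd[OF inj_z, of fp] f0 by (auto simp: fp P_def)
  obtain G where G: "gp = P * G"
    using newton_dvd[OF inj_z, of gp] g0 by (auto simp: gp P_def)
  \<comment> \<open>The degree of the first generator; removing the \<open>2 * h\<close> zeros
    \<open>z i\<close> leaves degree \<open>N\<close> for \<open>F\<close>.\<close>
  have Nh: "h * r + p = N + 2 * h"
  proof -
    have "r = (r - 2) + 2"
      using p_pos p_less by simp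
    then obtain q where "r = q + 2" ..
    then show ?thesis
      unfolding N by (simp add: algebra_simps)
  qed
  have b1nz: "b1 \<noteq> 0" and M: "degree ?M = r"
    using b1 by (auto simp: degree_monom_eq)
  have da1: "degree a1 \<le> h" and db2: "degree b2 \<le> h"
    by (rule degree_le; use a1 b2 in auto)+
  have top: "degree (monom 1 p * pcompose b1 ?M) = h * r + p" "lead_coeff (monom 1 p * pcompose b1 ?M) = 1"
  proof -
    have nz: "pcompose b1 ?M \<noteq> 0"
      using b1nz r_pos by (simp add: pcompose_eq_0_iff M)
    show "degree (monom 1 p * pcompose b1 ?M) = h * r + p"
      using nz by (subst degree_mult_eq) (auto simp: degree_monom_eq degree_pcompose M b1)
    show "lead_coeff (monom 1 p * pcompose b1 ?M) = 1"
      unfolding lead_coeff_mult using r_pos b1 by (simp add: lead_coeff_comp M degree_monom_eq)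
  qed
  have low: "degree (pcompose a1 ?M) < h * r + p"
    using da1 p_pos by (simp add: degree_pcompose M add_strict_increasing2 le_imp_less_Suc)
       (metis add.right_neutral add_le_less_mono mult_le_mono1)
  have fp_monic: "degree fp = h * r + p" "lead_coeff fp = 1"
    unfolding fp_def using low top by (simp_all add: degree_add_eq_right coeff_eq_0)
  have "F \<noteq> 0"
    using fp_monic(2) F by auto
  then have "degree fp = 2 * h + degree F"
    unfolding F P_def by (subst degree_mult_eq) auto
  then have degF: "degree F = N"
    using fp_monic(1) Nh by simp
  moreover have "lead_coeff F = 1"
    using fp_monic(2) unfolding F P_def lead_coeff_mult by simp
  ultimately obtain \<phi> where \<phi>: "F = newton \<phi> N"
    using alg_closed_newton[of F] by metis
  have degG: "degree G \<le> N"
  proof (cases "G = 0")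
    case False
    have "degree gp \<le> h * r + p"
      unfolding gp_def
    proof (rule degree_add_le)
      show "degree (pcompose a2 ?M) \<le> h * r + p"
        by (simp add: degree_pcompose M a2)
      have "degree (monom 1 p * pcompose b2 ?M) \<le> p + degree (pcompose b2 ?M)"
        using degree_mult_le[of "monom 1 p" "pcompose b2 ?M"] by (simp add: degree_monom_eq)
      also have "\<dots> \<le> p + h * r"
        using db2 by (simp add: degree_pcompose M)
      finally show "degree (monom 1 p * pcompose b2 ?M) \<le> h * r + p"
        by simp
    qed
    moreover have "degree gp = 2 * h + degree G"
      unfolding G P_def using False by (subst degree_mult_eq) auto
    ultimately show ?thesis using Nh by simp
  qed simp

  define s where "s = schur2 r p h z"
  define V where "V = vdm (2 * h) (\<lambda>i. z i ^ r)"
  define v where "v = vdm (2 * h) z"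
  define R where "R = (\<Prod>k<N. poly G (\<phi> k))"
  define c where "c = of_bool (h = 0 \<or> coprime p r) * (\<Prod>i<2 * h. z i) ^ ((p - 1) * (r - 1))"
  have v0: "v \<noteq> 0"
    unfolding v_def by (rule vdm_nonzero[OF inj_z])
  have V0: "V \<noteq> 0"
    unfolding V_def by (rule vdm_nonzero[OF inj_powers])
  have D: "D = (-1) ^ ((h choose 2) + h) * (s * v)"
    using v0 by (simp add: s_def schur2_def alternant_eq_D v_def power_add)
  have s0: "s \<noteq> 0"
    using D D_nonzero by auto
  have R_D: "R * D ^ r * V\<^sup>2 * (-1) ^ ((N + 1) * r * h) = c * V ^ r * v\<^sup>2"
    unfolding R_def V_def v_def c_def
    by (rule resultant_formula[OF a1 b1 a2 b2 _ _ \<phi>]) (simp_all add: F G flip: fp gp P_def)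
  have Dr: "D ^ r = (-1) ^ (((h choose 2) + h) * r) * (s ^ r * v ^ r)"
    unfolding D by (simp add: power_mult_distrib flip: power_mult)
  have split: "u ^ r = u ^ (r - 2) * u\<^sup>2" for u :: 'a
  proof -
    have "r - 2 + 2 = r"
      using p_pos p_less by simp
    then show ?thesis
      by (metis power_add)
  qed
  have "(V\<^sup>2 * v\<^sup>2) * (R * s ^ r * v ^ (r - 2) * ((-1) ^ (((h choose 2) + h) * r) * (-1) ^ ((N + 1) * r * h))) =
      (V\<^sup>2 * v\<^sup>2) * (c * V ^ (r - 2))"
    using R_D unfolding Dr split[of V] split[of v] by (simp only: mult_ac)
  then have "R * s ^ r * v ^ (r - 2) * ((-1) ^ (((h choose 2) + h) * r) * (-1) ^ ((N + 1) * r * h)) = c * V ^ (r - 2)"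
    using V0 v0 by simp
  \<comment> \<open>The two contributions \<open>r * h\<close> to the exponent cancel modulo
    2.\<close>
  also have "(-1) ^ (((h choose 2) + h) * r) * (-1) ^ ((N + 1) * r * h) = (-1 :: 'a) ^ (N * r * h + r * (h choose 2))"
    unfolding power_add[symmetric] minus_one_power_iff by auto
  finally have Rs: "R * s ^ r * v ^ (r - 2) * (-1) ^ (N * r * h + r * (h choose 2)) = c * V ^ (r - 2)" .
  have R: "R = (-1) ^ (N * r * h + r * (h choose 2)) * (c * (V / v) ^ (r - 2)) / s ^ r"
  proof -
    have "(-1) ^ (N * r * h + r * (h choose 2)) * (-1) ^ (N * r * h + r * (h choose 2)) = (1 :: 'a)"
      by (simp flip: power_add mult_2)
    then have "R * s ^ r * v ^ (r - 2) = (-1) ^ (N * r * h + r * (h choose 2)) * (c * V ^ (r - 2))"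
      unfolding Rs[symmetric] by (simp add: mult_ac)
    then show ?thesis
      using s0 v0 by (simp add: field_simps power_divide)
  qed

  have "fdet N (\<lambda>i j. schur2 r p (Suc h) (w i j)) =
        fdet N (\<lambda>i j. s * ((poly F (x i) * poly G (y j) - poly F (y j) * poly G (x i)) / (x i - y j)))"
    unfolding s_def
    by (rule fdet_cong, rule schur2_border[where \<alpha> = \<alpha> and \<beta> = \<beta>])
       (use x y xy in \<open>auto simp: w_def f g fp gp F G simp flip: P_def poly_mult fp gp\<close>)
  also have "\<dots> = s ^ N * fdet N (\<lambda>i j. (poly F (x i) * poly G (y j) - poly F (y j) * poly G (x i)) / (x i - y j))"
    by (subst fdet_mult_row) simp
  also have "fdet N (\<lambda>i j. (poly F (x i) * poly G (y j) - poly F (y j) * poly G (x i)) / (x i - y j)) =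
      (-1) ^ (N choose 2) * vdm N x * vdm N y * R"
    unfolding R_def by (rule det_bezout[OF degG, of x y]) (use xy in \<open>auto simp: \<phi>\<close>)
  finally have "fdet N (\<lambda>i j. schur2 r p (Suc h) (w i j)) = (-1) ^ ((N choose 2) + N * r * h + r * (h choose 2)) *
      vdm N x * vdm N y * c * (V / v) ^ (r - 2) * (s ^ N / s ^ r)"
    unfolding R by (simp add: power_add mult_ac)
  also have "s ^ N / s ^ r = s powi (int N - int r)"
    using s0 by (simp add: power_int_diff)
  finally show ?thesis
    by (simp add: c_def s_def V_def v_def mult_ac)
qed

end

section \<open>Indeterminates are generic\<close>

text \<open>Supplies the characteristic zero that \<open>generic_points\<close> demands of the
  algebraic closure of the field of fractions.\<close>

instance fract :: ("{idom, ring_char_0}") field_char_0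
proof
  show "inj (of_nat :: nat \<Rightarrow> 'a fract)"
    by (rule injI) (simp add: of_nat_fract eq_fract)
qed

section \<open>Transport along the embedding into the algebraic closure\<close>

interpretation to_ac: comm_ring_hom "to_ac :: 'a::field \<Rightarrow> 'a alg_closure"
  by unfold_locales simp_all

lemma to_ac_det: "to_ac (det (mat n m (\<lambda>(i, j). a i j))) = det (mat n m (\<lambda>(i, j). to_ac (a i j)))"
proof -
  have "map_mat to_ac (mat n m (\<lambda>(i, j). a i j)) = mat n m (\<lambda>(i, j). to_ac (a i j))"
    by (rule eq_matI) auto
  then show ?thesis
    by (metis to_ac.hom_det)
qed

lemma to_ac_schur:
  assumes "length zs = length lam"
  shows "to_ac (schur lam zs) = schur lam (map to_ac zs)"
proof -
  have *: "mat k k (\<lambda>(i, j). to_ac ((zs ! i) ^ e j)) = mat k k (\<lambda>(i, j). (map to_ac zs ! i) ^ e j)"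
    if "k = length lam" for k and e :: "nat \<Rightarrow> nat"
    by (rule eq_matI) (use that assms in auto)
  show ?thesis
    unfolding schur_def Let_def to_ac_divide to_ac_det by (simp only: *)
qed

lemma to_ac_Delta: "to_ac (Delta xs) = Delta (map to_ac xs)"
  unfolding Delta_def to_ac_prod length_map
  by (intro prod.cong refl) (auto simp: nth_map)

lemma to_ac_powi: "to_ac (x powi k) = to_ac x powi k"
  by (simp add: power_int_def)

text \<open>\<open>Delta\<close> and \<open>vdm\<close> differ by one sign per factor, and the signs
  of two equally long lists cancel.\<close>

lemma Delta_mult_Delta:
  assumes "length xs = n" "length ys = n"
  shows "Delta xs * Delta ys = vdm n ((!) xs) * vdm n ((!) ys)"
  unfolding Delta_def vdm_def assms prod.distrib[symmetric]
  by (intro prod.cong refl) (simp add: algebra_simps)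

section \<open>Schur polynomials of staircases as quotients of alternants\<close>

lemma det_vandermonde_desc:
  fixes ws :: "'a::idom list"
  shows "det (mat n n (\<lambda>(i, j). (ws ! i) ^ (n - Suc j))) = (-1) ^ (n choose 2) * vdm n ((!) ws)"
  using fdet_rev_cols[of n "\<lambda>i j. (ws ! i) ^ j"] by (simp add: fdet_vandermonde fdet_def)

text \<open>Adding the shift \<open>m - Suc j\<close> to the part \<open>(m - Suc j) * l\<close>
  gives a multiple of \<open>l + 1\<close>, so the numerator is a Vandermonde determinant in the
  powers \<open>z ^ (l + 1)\<close>.\<close>

lemma schur_staircase:
  fixes zs :: "'a::field list"
  shows "schur (staircase m l) zs = vdm m (\<lambda>i. (zs ! i) ^ (l + 1)) / vdm m ((!) zs)"
proof -
  have nth: "staircase m l ! j = (m - Suc j) * l" if "j < m" for j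
    using that by (simp add: staircase_def del: upt_Suc)
  have exponent: "staircase m l ! j + (m - Suc j) = (l + 1) * (m - Suc j)" if "j < m" for j
    unfolding nth[OF that] by (simp only: add_mult_distrib mult_1 mult.commute)
  have "det (mat m m (\<lambda>(i, j). (zs ! i) ^ (staircase m l ! j + (m - Suc j)))) =
        fdet m (\<lambda>i j. ((zs ! i) ^ (l + 1)) ^ (m - Suc j))"
    unfolding fdet_def[symmetric]
    by (rule fdet_cong) (simp only: exponent power_mult)
  also have "\<dots> = (-1) ^ (m choose 2) * vdm m (\<lambda>i. (zs ! i) ^ (l + 1))"
    by (subst fdet_rev_cols[of m "\<lambda>i j. ((zs ! i) ^ (l + 1)) ^ j"]) (simp only: fdet_vandermonde)
  finally show ?thesis
    unfolding schur_def Let_def length_staircase det_vandermonde_desc by simp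
qed

lemma interleave_nth:
  assumes "j < 2 * k"
  shows "(interleave (\<lambda>k i. w i ^ (k * (l + 2) + (l' + 1))) (\<lambda>k i. w i ^ (k * (l + 2))) k ! j) i =
    w i ^ (two_staircase k l l' ! j + (2 * k - Suc j))"
  using assms
proof (induction k arbitrary: j)
  case (Suc k)
  consider "j = 0" | "j = 1" | j' where "j = Suc (Suc j')" "j' < 2 * k"
    using Suc.prems by (metis One_nat_def Suc_less_SucD add_2_eq_Suc mult_Suc_right not0_implies_Suc)
  then show ?case
  proof cases
    case 3
    then show ?thesis
      using Suc.IH[of j'] by (simp add: two_staircase_Suc)
  qed (simp_all add: two_staircase_Suc algebra_simps mult_2_right)
qed simp

lemma alternant_eq_fdet:
  "alternant (l + 2) (l' + 1) k w = fdet (2 * k) (\<lambda>i j. w i ^ (two_staircase k l l' ! j + (2 * k - Suc j)))"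
  unfolding alternant_def cdet_def length_interleave by (rule fdet_cong) (simp only: interleave_nth)

lemma schur2_cong:
  assumes "\<And>i. i < 2 * k \<Longrightarrow> w i = w' i"
  shows "schur2 (l + 2) (l' + 1) k w = schur2 (l + 2) (l' + 1) k w'"
proof -
  have "alternant (l + 2) (l' + 1) k w = alternant (l + 2) (l' + 1) k w'"
    unfolding alternant_eq_fdet by (rule fdet_cong) (simp add: assms)
  moreover have "vdm (2 * k) w = vdm (2 * k) w'"
    unfolding vdm_def by (intro prod.cong refl) (simp add: assms)
  ultimately show ?thesis
    by (simp add: schur2_def)
qed

lemma schur_two_staircase:
  fixes ws :: "'a::field list"
  shows "schur (two_staircase k l l') ws = schur2 (l + 2) (l' + 1) k ((!) ws)"
proof -
  have "(-1) ^ (2 * k choose 2) = ((-1) ^ k :: 'a)"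
    by (cases k) (simp_all add: choose_two minus_one_power_iff)
  then show ?thesis
    unfolding schur_def Let_def length_two_staircase det_vandermonde_desc schur2_def
      alternant_eq_fdet fdet_def by simp
qed

section \<open>Generalized Vandermonde determinants of indeterminates\<close>

lemma signof_single: "signof \<pi> * Poly_Mapping.single m (1 :: int) = Poly_Mapping.single m (signof \<pi>)"
  by (simp add: sign_def single_uminus)

lemma prod_single:
  "(\<Prod>i\<in>A. Poly_Mapping.single (m i) 1) = Poly_Mapping.single (\<Sum>i\<in>A. m i) (1 :: 'b::comm_semiring_1)"
  by (induction A rule: infinite_finite_induct) (simp_all add: mult_single one_poly_mapping_def single_one)

text \<open>In the Leibniz expansion every permutation contributes one monomial with coefficient 1
  or -1. As indeterminates and exponents are distinct, only the identity yields the diagonal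
  monomial, which therefore survives with coefficient 1.\<close>

lemma fdet_monomials_nonzero:
  fixes \<sigma> \<epsilon> :: "nat \<Rightarrow> nat"
  assumes \<sigma>: "inj_on \<sigma> {..<n}" and \<epsilon>: "inj_on \<epsilon> {..<n}"
  shows "fdet n (\<lambda>i j. Poly_Mapping.single (Poly_Mapping.single (\<sigma> i) (\<epsilon> j)) (1 :: int)) \<noteq> 0"
    (is "fdet n ?a \<noteq> 0")
proof -
  let ?P = "{\<pi>. \<pi> permutes {0..<n}}"
  define m where "m \<pi> = (\<Sum>i\<in>{0..<n}. Poly_Mapping.single (\<sigma> i) (\<epsilon> (\<pi> i)))" for \<pi>
  have m: "Poly_Mapping.lookup (m \<pi>) (\<sigma> i) = \<epsilon> (\<pi> i)" if "i < n" for \<pi> i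
  proof -
    have "Poly_Mapping.lookup (m \<pi>) (\<sigma> i) = (\<Sum>k\<in>{0..<n}. if k = i then \<epsilon> (\<pi> i) else 0)"
      unfolding m_def Poly_Mapping.lookup_sum
      by (rule sum.cong) (use inj_on_eq_iff[OF \<sigma>] that in \<open>auto simp: lookup_single when_def\<close>)
    then show ?thesis using that by simp
  qed
  have eq_id: "\<pi> = id" if "\<pi> \<in> ?P" "m \<pi> = m id" for \<pi>
  proof
    fix i
    show "\<pi> i = id i"
    proof (cases "i < n")
      case True
      then have "\<pi> i < n"
        using that(1) permutes_in_image[of \<pi> "{0..<n}" i] by auto
      moreover have "\<epsilon> (\<pi> i) = \<epsilon> i"
        using m[OF True, of \<pi>] m[OF True, of id] that(2) by simp
      ultimately show ?thesis
        using inj_on_eq_iff[OF \<epsilon>] True by auto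
    next
      case False
      then show ?thesis
        using that(1) by (auto simp: permutes_def)
    qed
  qed
  have "fdet n ?a = (\<Sum>\<pi>\<in>?P. signof \<pi> * (\<Prod>i = 0..<n. ?a i (\<pi> i)))"
    unfolding fdet_def
    by (subst det_def'[of _ n]) (auto intro!: sum.cong prod.cong arg_cong2[of _ _ _ _ "(*)"])
  also have "\<dots> = (\<Sum>\<pi>\<in>?P. Poly_Mapping.single (m \<pi>) (signof \<pi>))"
    by (simp add: prod_single signof_single m_def)
  finally have "Poly_Mapping.lookup (fdet n ?a) (m id) =
      (\<Sum>\<pi>\<in>?P. Poly_Mapping.lookup (Poly_Mapping.single (m \<pi>) (signof \<pi>)) (m id))"
    by (simp only: Poly_Mapping.lookup_sum)
  also have "\<dots> = (\<Sum>\<pi>\<in>?P. if \<pi> = id then 1 else 0)"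
    by (rule sum.cong) (use eq_id in \<open>auto simp: lookup_single when_def\<close>)
  also have "\<dots> = 1"
    by (simp add: finite_permutations permutes_id)
  finally show ?thesis
    by auto
qed

lemma indet_power: "indet i ^ e = Fract (Poly_Mapping.single (Poly_Mapping.single i e) 1) 1"
proof (induction e)
  case 0
  then show ?case
    by (simp add: One_fract_def)
next
  case (Suc e)
  then show ?case
    by (simp add: indet_def mult_single single_add[symmetric])
qed

lemma fdet_indet_nonzero:
  fixes \<sigma> \<epsilon> :: "nat \<Rightarrow> nat"
  assumes "inj_on \<sigma> {..<n}" "inj_on \<epsilon> {..<n}"
  shows "fdet n (\<lambda>i j. indet (\<sigma> i) ^ \<epsilon> j) \<noteq> 0"
proof -
  interpret comm_ring_hom "\<lambda>a :: int_mpoly. Fract a 1"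
    by unfold_locales (simp_all add: Zero_fract_def One_fract_def)
  let ?a = "\<lambda>i j. Poly_Mapping.single (Poly_Mapping.single (\<sigma> i) (\<epsilon> j)) (1 :: int)"
  have "map_mat (\<lambda>a. Fract a 1) (mat n n (\<lambda>(i, j). ?a i j)) = mat n n (\<lambda>(i, j). indet (\<sigma> i) ^ \<epsilon> j)"
    by (rule eq_matI) (auto simp: indet_power)
  then have "fdet n (\<lambda>i j. indet (\<sigma> i) ^ \<epsilon> j) = Fract (fdet n ?a) 1"
    unfolding fdet_def by (metis hom_det)
  moreover have "Fract a 1 \<noteq> 0" if "a \<noteq> 0" for a :: int_mpoly
    unfolding Zero_fract_def using that by (simp only: eq_fract one_neq_zero not_False_eq_True) simp
  ultimately show ?thesis
    using fdet_monomials_nonzero[OF assms] by metis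
qed

text \<open>A vanishing sparse polynomial gives a kernel vector of a generalized Vandermonde matrix
  in distinct indeterminates, and this matrix is nonsingular.\<close>

lemma generic_points_indet:
  assumes p: "0 < p" "p < r" and z: "\<And>i. i < 2 * h \<Longrightarrow> z i = to_ac (indet i)"
  shows "generic_points h r p z"
proof
  fix S I c e
  assume S: "finite S" "I \<subseteq> {..<2 * h}" "card S \<le> card I" "e \<in> S"
    and zero: "\<And>i. i \<in> I \<Longrightarrow> (\<Sum>e\<in>S. c e * z i ^ e) = 0"
  let ?n = "card S"
  \<comment> \<open>Keeping only \<open>card S\<close> of the points makes the linear system
    square.\<close>
  obtain I' where I': "I' \<subseteq> I" "card I' = ?n" "finite I'"
    using S(2,3) by (meson finite_lessThan finite_subset obtain_subset_with_card_n)
  obtain \<sigma> where \<sigma>: "bij_betw \<sigma> {..<?n} I'"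
    using ex_bij_betw_nat_finite[OF I'(3)] I'(2) by (auto simp: atLeast0LessThan)
  obtain \<epsilon> where \<epsilon>: "bij_betw \<epsilon> {..<?n} S"
    using ex_bij_betw_nat_finite[OF S(1)] by (auto simp: atLeast0LessThan)
  have "fdet ?n (\<lambda>i j. indet (\<sigma> i) ^ \<epsilon> j) \<noteq> 0"
    using fdet_indet_nonzero[of \<sigma> ?n \<epsilon>] \<sigma> \<epsilon> by (simp add: bij_betw_def)
  then have "to_ac (fdet ?n (\<lambda>i j. indet (\<sigma> i) ^ \<epsilon> j)) \<noteq> 0"
    by (simp only: to_ac_eq_0_iff not_False_eq_True)
  moreover have "to_ac (fdet ?n (\<lambda>i j. indet (\<sigma> i) ^ \<epsilon> j)) =
      fdet ?n (\<lambda>i j. to_ac (indet (\<sigma> i)) ^ \<epsilon> j)"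
    unfolding fdet_def to_ac_det to_ac_power ..
  ultimately have nz: "fdet ?n (\<lambda>i j. to_ac (indet (\<sigma> i)) ^ \<epsilon> j) \<noteq> 0"
    by simp
  have sums: "(\<Sum>j<?n. to_ac (indet (\<sigma> i)) ^ \<epsilon> j * c (\<epsilon> j)) = 0" if "i < ?n" for i
  proof -
    have "\<sigma> i \<in> I"
      using \<sigma> that I'(1) by (auto simp: bij_betw_def)
    then have "(\<Sum>e\<in>S. c e * to_ac (indet (\<sigma> i)) ^ e) = 0"
      using zero[of "\<sigma> i"] z[of "\<sigma> i"] S(2) by auto
    then show ?thesis
      by (simp add: sum.reindex_bij_betw[OF \<epsilon>, symmetric] mult.commute)
  qed
  have "e \<in> \<epsilon> ` {..<?n}"
    using \<epsilon> S(4) by (simp add: bij_betw_def)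
  then obtain j where "j < ?n" "\<epsilon> j = e"
    by auto
  then show "c e = 0"
    using fdet_kernel_trivial[OF nz sums, of j] by simp
qed (use p in auto)

section \<open>Parity of the sign exponent\<close>

lemma choose_two_mult: "(l * h) choose 2 = h * (l choose 2) + l * l * (h choose 2)"
proof (induction h)
  case (Suc h)
  have "(a + b) choose 2 = (a choose 2) + (b choose 2) + a * b" for a b :: nat
    by (induction b) (simp_all add: numeral_2_eq_2)
  then have "(l + l * h) choose 2 = (l choose 2) + ((l * h) choose 2) + l * (l * h)"
    by blast
  moreover have "Suc h choose 2 = (h choose 2) + h"
    by (simp add: numeral_2_eq_2)
  ultimately show ?case
    unfolding mult_Suc_right Suc.IH by (simp add: algebra_simps)
qed (simp add: numeral_2_eq_2)

text \<open>Matches the sign of \<open>det_schur2\<close> with \<open>det_const\<close>. Modulo 2,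
  \<open>N * (l + 2) * h\<close> is \<open>l * h + l * h * p\<close>; its second term cancels
  against \<open>N choose 2\<close>, as do the multiples of \<open>h choose 2\<close>, and
  \<open>h * (l choose 2) + l * h\<close> is \<open>h * ((l + 1) choose 2)\<close>.\<close>

lemma even_exponent:
  fixes l h p :: nat
  defines "N \<equiv> l * h + p"
  shows "even ((N choose 2) + N * (l + 2) * h + (l + 2) * (h choose 2)) \<longleftrightarrow>
    even (h * ((l + 1) choose 2) + (p choose 2))"
proof -
  have "(a + b) choose 2 = (a choose 2) + (b choose 2) + a * b" for a b :: nat
    by (induction b) (simp_all add: numeral_2_eq_2)
  then have "N choose 2 = h * (l choose 2) + l * l * (h choose 2) + (p choose 2) + l * h * p"
    by (simp add: N_def choose_two_mult)
  moreover have "(l + 1) choose 2 = (l choose 2) + l"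
    by (simp add: numeral_2_eq_2)
  ultimately show ?thesis
    by (auto simp: N_def)
qed

text \<open>The identity is established for the images in the algebraic closure, where roots of
  \<open>F\<close> and of unity are available, and pulled back along the injective
  \<open>to_ac\<close>. The power is an integer power because its exponent can be negative for
  \<open>n = 1\<close>, where the base is the Schur polynomial of the empty partition.\<close>

theorem theorem2:
  fixes n l l' N :: nat
    and xs ys zs :: "int_mpoly fract list"
  assumes "n \<ge> 1" and "l' \<le> l"
    and "N = l * (n - 1) + l' + 1"
    and "zs = map indet [0..<2 * n - 2]"
    and "xs = map indet [2 * n - 2..<2 * n - 2 + N]"
    and "ys = map indet [2 * n - 2 + N..<2 * n - 2 + 2 * N]"
  shows "det (mat N N (\<lambda>(i, j). schur (two_staircase n l l') (zs @ [xs ! i, ys ! j]))) =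
           of_int (det_const n l l') * Delta xs * Delta ys *
           (\<Prod>i<2 * n - 2. (zs ! i) ^ (l' * (l + 1))) *
           schur (staircase (2 * n - 2) (l + 1)) zs ^ l *
           schur (two_staircase (n - 1) l l') zs powi (int l * (int n - 2) + int l' - 1)"
proof -
  define h where "h = n - 1"
  have n: "n = Suc h" and h: "2 * n - 2 = 2 * h"
    using assms(1) by (auto simp: h_def)
  define x y z where "x = (!) (map to_ac xs)" and "y = (!) (map to_ac ys)" and "z = (!) (map to_ac zs)"
  have len: "length zs = 2 * h" "length xs = N" "length ys = N"
    by (simp_all add: assms(4-6) h)
  have z: "z i = to_ac (indet i)" if "i < 2 * h" for i
    using that by (simp add: z_def assms(4) h)
  have x: "x i = to_ac (indet (2 * h + i))" and y: "y i = to_ac (indet (2 * h + N + i))" if "i < N" for i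
    using that by (simp_all add: x_def y_def assms(5,6) h)
  interpret generic_points h "l + 2" "l' + 1" z
    by (rule generic_points_indet) (use assms(2) z in auto)
  have N: "N = h * (l + 2 - 2) + (l' + 1)"
    by (simp add: assms(3) h_def)
  let ?w = "\<lambda>i j k. if k < 2 * h then z k else if k = 2 * h then x i else y j"
  have "to_ac (det (mat N N (\<lambda>(i, j). schur (two_staircase n l l') (zs @ [xs ! i, ys ! j])))) =
        fdet N (\<lambda>i j. to_ac (schur (two_staircase n l l') (zs @ [xs ! i, ys ! j])))"
    by (simp only: to_ac_det fdet_def)
  also have "\<dots> = fdet N (\<lambda>i j. schur2 (l + 2) (l' + 1) (Suc h) (?w i j))"
  proof (rule fdet_cong)
    fix i j assume ij: "i < N" "j < N"
    have "to_ac (schur (two_staircase n l l') (zs @ [xs ! i, ys ! j])) =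
        schur2 (l + 2) (l' + 1) (Suc h) ((!) (map to_ac (zs @ [xs ! i, ys ! j])))"
      by (subst to_ac_schur) (simp_all add: len n schur_two_staircase)
    also have "\<dots> = schur2 (l + 2) (l' + 1) (Suc h) (?w i j)"
    proof (rule schur2_cong)
      fix k assume "k < 2 * Suc h"
      then have "k < Suc (Suc (2 * h))"
        by simp
      then consider "k < 2 * h" | "k = 2 * h" | "k = Suc (2 * h)"
        by linarith
      then show "map to_ac (zs @ [xs ! i, ys ! j]) ! k = ?w i j k"
        by cases (simp_all add: nth_append len x_def y_def z_def ij)
    qed
    finally show "to_ac (schur (two_staircase n l l') (zs @ [xs ! i, ys ! j])) =
        schur2 (l + 2) (l' + 1) (Suc h) (?w i j)" .
  qed
  also have "\<dots> = (-1) ^ ((N choose 2) + N * (l + 2) * h + (l + 2) * (h choose 2)) *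
    of_bool (h = 0 \<or> coprime (l' + 1) (l + 2)) * vdm N x * vdm N y *
    (\<Prod>i<2 * h. z i) ^ ((l' + 1 - 1) * (l + 2 - 1)) *
    (vdm (2 * h) (\<lambda>i. z i ^ (l + 2)) / vdm (2 * h) z) ^ (l + 2 - 2) *
    schur2 (l + 2) (l' + 1) h z powi (int N - int (l + 2))"
    by (rule det_schur2[OF N]) (auto simp: x y z indet_eq_iff)
  also have "(-1) ^ ((N choose 2) + N * (l + 2) * h + (l + 2) * (h choose 2)) *
    of_bool (h = 0 \<or> coprime (l' + 1) (l + 2)) = (to_ac (of_int (det_const n l l')) :: int_mpoly fract alg_closure)"
  proof -
    have "h = 0 \<or> coprime (l' + 1) (l + 2) \<longleftrightarrow> n = 1 \<or> gcd (l + 2) (l' + 1) = 1"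
      by (simp only: n coprime_iff_gcd_eq_1 gcd.commute[of "l + 2"]) simp
    moreover have "even ((N choose 2) + N * (l + 2) * h + (l + 2) * (h choose 2)) \<longleftrightarrow>
        even ((n - 1) * ((l + 1) choose 2) + ((l' + 1) choose 2))"
      using even_exponent[of l h "l' + 1"] by (simp only: assms(3) h_def add.assoc)
    ultimately show ?thesis
      by (simp add: det_const_def minus_one_power_iff)
  qed
  also have "to_ac (of_int (det_const n l l')) * vdm N x * vdm N y =
      to_ac (of_int (det_const n l l')) * (to_ac (Delta xs) * to_ac (Delta ys))"
    by (simp add: to_ac_Delta Delta_mult_Delta[of _ N] len x_def y_def mult.assoc)
  also have "(\<Prod>i<2 * h. z i) ^ ((l' + 1 - 1) * (l + 2 - 1)) = to_ac (\<Prod>i<2 * n - 2. (zs ! i) ^ (l' * (l + 1)))"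
    unfolding h by (simp add: to_ac_prod prod_power_distrib z_def len)
  also have "vdm (2 * h) (\<lambda>i. z i ^ (l + 2)) / vdm (2 * h) z = to_ac (schur (staircase (2 * n - 2) (l + 1)) zs)"
    by (subst to_ac_schur) (simp_all add: h len schur_staircase z_def)
  also have "schur2 (l + 2) (l' + 1) h z = to_ac (schur (two_staircase (n - 1) l l') zs)"
    by (subst to_ac_schur) (simp_all add: len n schur_two_staircase z_def)
  also have "int N - int (l + 2) = int l * (int n - 2) + int l' - 1"
    by (simp add: assms(3) n algebra_simps)
  finally have "to_ac (det (mat N N (\<lambda>(i, j). schur (two_staircase n l l') (zs @ [xs ! i, ys ! j])))) =
    to_ac (of_int (det_const n l l') * Delta xs * Delta ys *
           (\<Prod>i<2 * n - 2. (zs ! i) ^ (l' * (l + 1))) *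
           schur (staircase (2 * n - 2) (l + 1)) zs ^ l *
           schur (two_staircase (n - 1) l l') zs powi (int l * (int n - 2) + int l' - 1))"
    by (simp add: to_ac_powi mult.assoc)
  then show ?thesis
    by (simp only: to_ac_eq_iff)
qed

end
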